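(* Let $G$ be a connected unicyclic graph with no sprouts and with $r\ge2$ non-trivial rooted trees attached to its cycle. Let $u_1,\dots,u_p$ be the (non-sprout) deep vertices of $G$ and $d_i=\deg(u_i)$. Then the leading coefficient of $\mathbf{X}_G$ is \[c_{\lambda_{\mathrm{lead}}}=(-1)^p\prod_{i=1}^p(d_i-1).\]
   Context: All graphs are finite and simple. The chromatic symmetric function of a graph $G$ with vertices $v_1,\dots,v_n$ is $\mathbf{X}_G=\sum_\kappa x_{\kappa(v_1)}\cdots x_{\kappa(v_n)}$, summed over all proper colorings $\kappa:V(G)\to\mathbb{N}$. The star graph $\mathsf{St}_k$ on $k$ vertices is the tree with one central vertex adjacent to $k-1$ leaves ($\mathsf{St}_1$ is a single vertex); $\mathfrak{st}_k:=\mathbf{X}_{\mathsf{St}_k}$, and $\mathfrak{st}_\lambda:=\mathfrak{st}_{\lambda_1}\mathfrak{st}_{\lambda_2}\cdots$ for a partition $\lambda$. The set $\{\mathfrak{st}_\lambda:\lambda\vdash n\}$ is a $\mathbb{Q}$-basis (the star-basis) of the space of homogeneous symmetric functions of degree $n$, so $\mathbf{X}_G=\sum_{\lambda\vdash n}c_\lambda\mathfrak{st}_\lambda$ with uniquely determined coefficients. Partitions of $n$ are ordered lexicographically: $\mu\le\lambda$ if $\mu=\lambda$ or, for some $j$, $\mu_i=\lambda_i$ for $i<j$ and $\mu_j<\lambda_j$. The leading partition $\lambda_{\mathrm{lead}}$ is the smallest partition $\lambda$ in lexicographic order with $c_\lambda\ne0$, and $c_{\lambda_{\mathrm{lead}}}$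 is the leading coefficient. A unicyclic graph is a graph containing exactly one cycle. If $G$ is connected unicyclic with cycle vertices $v_1,\dots,v_c$, then deleting the edges of the cycle leaves $c$ trees $T_1,\dots,T_c$ with $T_i$ containing (and rooted at) $v_i$; $T_i$ is non-trivial if it has more than one vertex. A leaf is a vertex of degree one; an internal vertex is a vertex of degree at least two; a deep vertex is an internal vertex with no adjacent leaves. A sprout is a deep vertex that lies on the cycle and has degree at least three. Empty products equal $1$. *)

theory Defs
  imports Complex_Main "HOL-Library.Multiset" "HOL-Library.FuncSet" "HOL-Library.List_Lexorder"
begin

section \<open>Finite simple graphs\<close>

definition simple_graph :: "'a set \<Rightarrow> 'a set set \<Rightarrow> bool" where
  "simple_graph V E \<longleftrightarrow> finite V \<and> (\<forall>e\<in>E. e \<subseteq> V \<and> card e = 2)"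

definition adj_rel :: "'a set set \<Rightarrow> ('a \<times> 'a) set" where
  "adj_rel E = {(u, v). {u, v} \<in> E}"

definition component :: "'a set \<Rightarrow> 'a set set \<Rightarrow> 'a \<Rightarrow> 'a set" where
  "component V E v = {w \<in> V. (v, w) \<in> (adj_rel E)\<^sup>*}"

definition connected_graph :: "'a set \<Rightarrow> 'a set set \<Rightarrow> bool" where
  "connected_graph V E \<longleftrightarrow> V \<noteq> {} \<and> (\<forall>u\<in>V. \<forall>v\<in>V. (u, v) \<in> (adj_rel E)\<^sup>*)"

definition degree :: "'a set set \<Rightarrow> 'a \<Rightarrow> nat" where
  "degree E v = card {e \<in> E. v \<in> e}"

definition closed_walk_edges :: "'a list \<Rightarrow> 'a set set" where
  "closed_walk_edges vs = {{vs ! i, vs ! (Suc i mod length vs)} | i. i < length vs}"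

text \<open>A cycle is a subgraph, identified with its edge set, so that the choice of a starting
  vertex and of a direction does not matter when cycles are counted.\<close>

definition cycles :: "'a set set \<Rightarrow> 'a set set set" where
  "cycles E = {closed_walk_edges vs | vs.
     length vs \<ge> 3 \<and> distinct vs \<and> closed_walk_edges vs \<subseteq> E}"

definition unicyclic :: "'a set set \<Rightarrow> bool" where
  "unicyclic E \<longleftrightarrow> (\<exists>!C. C \<in> cycles E)"

definition the_cycle :: "'a set set \<Rightarrow> 'a set set" where
  "the_cycle E = (THE C. C \<in> cycles E)"

definition cycle_vertices :: "'a set set \<Rightarrow> 'a set" where
  "cycle_vertices E = \<Union>(the_cycle E)"

text \<open>The vertex set of the tree rooted at the cycle vertex \<open>v\<close>.\<close>

definition rooted_tree :: "'a set \<Rightarrow> 'a set set \<Rightarrow> 'a \<Rightarrow> 'a set" where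
  "rooted_tree V E v = component V (E - the_cycle E) v"

text \<open>The non-trivial rooted trees are indexed by their roots.\<close>

definition nontrivial_roots :: "'a set \<Rightarrow> 'a set set \<Rightarrow> 'a set" where
  "nontrivial_roots V E = {v \<in> cycle_vertices E. card (rooted_tree V E v) > 1}"

definition leaf :: "'a set \<Rightarrow> 'a set set \<Rightarrow> 'a \<Rightarrow> bool" where
  "leaf V E v \<longleftrightarrow> v \<in> V \<and> degree E v = 1"

definition internal :: "'a set \<Rightarrow> 'a set set \<Rightarrow> 'a \<Rightarrow> bool" where
  "internal V E v \<longleftrightarrow> v \<in> V \<and> degree E v \<ge> 2"

definition deep :: "'a set \<Rightarrow> 'a set set \<Rightarrow> 'a \<Rightarrow> bool" where
  "deep V E v \<longleftrightarrow> internal V E v \<and> \<not> (\<exists>w. leaf V E w \<and> {v, w} \<in> E)"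

definition sprout :: "'a set \<Rightarrow> 'a set set \<Rightarrow> 'a \<Rightarrow> bool" where
  "sprout V E v \<longleftrightarrow> deep V E v \<and> v \<in> cycle_vertices E \<and> degree E v \<ge> 3"


section \<open>Power series in countably many variables\<close>

text \<open>A monomial in the variables \<open>x\<^sub>0, x\<^sub>1, \<dots>\<close> is the multiset of its indices; a formal power series
  is its coefficient function. Every monomial has only finitely many divisors, so the sum in the
  product is finite.\<close>

type_synonym series = "nat multiset \<Rightarrow> rat"

definition series_one :: series where
  "series_one M = (if M = {#} then 1 else 0)"

definition series_mult :: "series \<Rightarrow> series \<Rightarrow> series" where
  "series_mult f g M = (\<Sum>A | A \<subseteq># M. f A * g (M - A))"


section \<open>Chromatic symmetric functions and the star-basis\<close>

definition proper_colorings :: "'a set \<Rightarrow> 'a set set \<Rightarrow> ('a \<Rightarrow> nat) set" where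
  "proper_colorings V E =
     {\<kappa> \<in> V \<rightarrow>\<^sub>E UNIV. \<forall>u v. {u, v} \<in> E \<longrightarrow> \<kappa> u \<noteq> \<kappa> v}"

text \<open>The coefficient of \<open>M\<close> is the number of proper colorings whose color multiset is \<open>M\<close>.\<close>

definition chromatic_symfun :: "'a set \<Rightarrow> 'a set set \<Rightarrow> series" where
  "chromatic_symfun V E M =
     of_nat (card {\<kappa> \<in> proper_colorings V E. image_mset \<kappa> (mset_set V) = M})"

definition star_edges :: "nat \<Rightarrow> nat set set" where
  "star_edges k = {{0, i} | i. 1 \<le> i \<and> i < k}"

definition star_symfun :: "nat \<Rightarrow> series" where
  "star_symfun k = chromatic_symfun {0..<k} (star_edges k)"

definition partitions :: "nat \<Rightarrow> nat list set" where
  "partitions n = {ps. sorted_wrt (\<ge>) ps \<and> (\<forall>k\<in>set ps. k > 0) \<and> sum_list ps = n}"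

definition star_product :: "nat list \<Rightarrow> series" where
  "star_product ps = foldr (\<lambda>k. series_mult (star_symfun k)) ps series_one"

definition star_expansion :: "nat \<Rightarrow> series \<Rightarrow> (nat list \<Rightarrow> rat) \<Rightarrow> bool" where
  "star_expansion n f c \<longleftrightarrow>
     (\<forall>ps. ps \<notin> partitions n \<longrightarrow> c ps = 0) \<and>
     f = (\<lambda>M. \<Sum>ps\<in>partitions n. c ps * star_product ps M)"

definition star_coeffs :: "nat \<Rightarrow> series \<Rightarrow> nat list \<Rightarrow> rat" where
  "star_coeffs n f = (THE c. star_expansion n f c)"

text \<open>The minimum is taken in the linear order on lists from \<open>List_Lexorder\<close>. That order puts a
  proper prefix before its extensions, but no partition of \<open>n\<close> is a proper prefix of another.\<close>

definition lead_partition :: "nat \<Rightarrow> series \<Rightarrow> nat list" where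
  "lead_partition n f = Min {ps \<in> partitions n. star_coeffs n f ps \<noteq> 0}"

definition leading_coeff :: "nat \<Rightarrow> series \<Rightarrow> rat" where
  "leading_coeff n f = star_coeffs n f (lead_partition n f)"

end

theory Submission
  imports Defs "HOL-Library.Function_Algebras"
begin

text \<open>
  Let \<open>W\<close> be the set of internal vertices, \<open>I\<close> the set of edges inside \<open>W\<close> and \<open>N\<close> the set of non-deep
  internal vertices. Inclusion-exclusion over \<open>I\<close>, followed by writing every monochromatic
  component as a signed sum of stars, gives
  \<open>X\<^sub>G = \<Sum> (-1)\<^bsup>|S| + |B|\<^esup> st\<^bsub>type(S, B)\<^esub>\<close>, summed over \<open>S \<subseteq> I\<close> and sets \<open>B\<close> of internal
  vertices that contain no chosen representative of a component of \<open>S\<close>. Choosing the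
  representatives in \<open>N\<close> whenever possible, \<open>type(S, B)\<close> is at least the partition formed by the
  numbers \<open>1 + #leaves at w\<close> for \<open>w \<in> W\<close>, with equality iff \<open>B\<close> is empty and no component of \<open>S\<close>
  contains two vertices of \<open>N\<close>. So the leading coefficient is the sum of \<open>(-1)\<^bsup>|S|\<^esup>\<close> over these \<open>S\<close>.
  The roots of the non-trivial trees lie in \<open>N\<close>, as there are no sprouts, so the cycle contains
  two vertices of \<open>N\<close> and every such \<open>S\<close> is a forest; by induction on the number of deep
  vertices the sum is the product of \<open>1 - d\<^sub>i\<close>.
\<close>

section \<open>Chromatic symmetric functions of star forests\<close>

text \<open>Properness is left out on purpose: for finite \<open>V\<close> and fixed
  \<open>M\<close> this is a finite set independent of the edges, so the coefficients for different
  edge sets are sums of indicators over one common range, where inclusion-exclusion applies.\<close>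

definition colorings_with :: "'a set \<Rightarrow> nat multiset \<Rightarrow> ('a \<Rightarrow> nat) set" where
  "colorings_with V M = {\<kappa> \<in> V \<rightarrow>\<^sub>E UNIV. image_mset \<kappa> (mset_set V) = M}"

lemma finite_colorings_with: "finite V \<Longrightarrow> finite (colorings_with V M)"
proof (rule finite_subset)
  assume V: "finite V"
  show "colorings_with V M \<subseteq> V \<rightarrow>\<^sub>E set_mset M"
  proof
    fix \<kappa> assume "\<kappa> \<in> colorings_with V M"
    then have k: "\<kappa> \<in> V \<rightarrow>\<^sub>E UNIV" and M: "M = image_mset \<kappa> (mset_set V)"
      by (auto simp: colorings_with_def)
    show "\<kappa> \<in> V \<rightarrow>\<^sub>E set_mset M"
      using k V by (auto simp: M PiE_def)
  qed
  show "finite (V \<rightarrow>\<^sub>E set_mset M)" using V by (intro finite_PiE) auto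
qed

lemma chromatic_symfun_sum:
  assumes "finite V"
  shows "chromatic_symfun V E M =
    (\<Sum>\<kappa>\<in>colorings_with V M. of_bool (\<forall>u v. {u, v} \<in> E \<longrightarrow> \<kappa> u \<noteq> \<kappa> v))"
proof -
  have "{\<kappa> \<in> proper_colorings V E. image_mset \<kappa> (mset_set V) = M} =
    {\<kappa> \<in> colorings_with V M. \<forall>u v. {u, v} \<in> E \<longrightarrow> \<kappa> u \<noteq> \<kappa> v}"
    by (auto simp: proper_colorings_def colorings_with_def)
  then show ?thesis
    unfolding chromatic_symfun_def of_bool_def
    using finite_colorings_with[OF assms, of M]
    by (simp add: sum.If_cases Int_def)
qed

text \<open>A coloring of the union is an independent pair of colorings, and its color multiset is
  the sum of theirs.\<close>

lemma chromatic_symfun_disjoint_union: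
  assumes fin: "finite V1" "finite V2" and disj: "V1 \<inter> V2 = {}"
    and E: "\<Union>E1 \<subseteq> V1" "\<Union>E2 \<subseteq> V2"
  shows "chromatic_symfun (V1 \<union> V2) (E1 \<union> E2) =
    series_mult (chromatic_symfun V1 E1) (chromatic_symfun V2 E2)"
proof
  fix M
  define K where "K = {\<kappa> \<in> proper_colorings (V1 \<union> V2) (E1 \<union> E2). image_mset \<kappa> (mset_set (V1 \<union> V2)) = M}"
  define K1 where "K1 A = {\<kappa> \<in> proper_colorings V1 E1. image_mset \<kappa> (mset_set V1) = A}" for A
  define K2 where "K2 A = {\<kappa> \<in> proper_colorings V2 E2. image_mset \<kappa> (mset_set V2) = A}" for A
  have finK1: "finite (K1 A)" for A
    by (rule finite_subset[OF _ finite_colorings_with[OF fin(1), of A]])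
      (auto simp: K1_def proper_colorings_def colorings_with_def)
  have finK2: "finite (K2 A)" for A
    by (rule finite_subset[OF _ finite_colorings_with[OF fin(2), of A]])
      (auto simp: K2_def proper_colorings_def colorings_with_def)
  have finM: "finite {A. A \<subseteq># M}"
  proof -
    have "{A. A \<subseteq># M} \<subseteq> (\<Union>n\<in>{..size M}. multisets_of_size (set_mset M) n)"
      by (auto simp: multisets_of_size_def dest: size_mset_mono mset_subset_eqD)
    then show ?thesis by (rule finite_subset) auto
  qed
  have mset_un: "mset_set (V1 \<union> V2) = mset_set V1 + mset_set V2"
    using fin disj by (rule mset_set_Union)
  have restrict1: "image_mset (restrict \<kappa> V1) (mset_set V1) = image_mset \<kappa> (mset_set V1)" for \<kappa> :: "'a \<Rightarrow> nat"
    using fin by (intro image_mset_cong) auto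
  have restrict2: "image_mset (restrict \<kappa> V2) (mset_set V2) = image_mset \<kappa> (mset_set V2)" for \<kappa> :: "'a \<Rightarrow> nat"
    using fin by (intro image_mset_cong) auto
  have in1: "u \<in> V1 \<and> v \<in> V1" if "{u, v} \<in> E1" for u v using that E by blast
  have in2: "u \<in> V2 \<and> v \<in> V2" if "{u, v} \<in> E2" for u v using that E by blast
  define m where "m \<kappa>1 \<kappa>2 = (\<lambda>v. if v \<in> V1 then \<kappa>1 v else \<kappa>2 v)" for \<kappa>1 \<kappa>2 :: "'a \<Rightarrow> nat"
  have m1: "image_mset (m \<kappa>1 \<kappa>2) (mset_set V1) = image_mset \<kappa>1 (mset_set V1)" for \<kappa>1 \<kappa>2
    using fin by (intro image_mset_cong) (auto simp: m_def)
  have m2: "image_mset (m \<kappa>1 \<kappa>2) (mset_set V2) = image_mset \<kappa>2 (mset_set V2)" for \<kappa>1 \<kappa>2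
    using fin disj by (intro image_mset_cong) (auto simp: m_def)
  \<comment> \<open>The divisor \<open>A\<close> of \<open>M\<close> is carried along as the color
    multiset on \<open>V1\<close>, so that the cardinality of the target is the convolution in
    \<open>series_mult\<close>.\<close>
  have "bij_betw (\<lambda>\<kappa>. (image_mset \<kappa> (mset_set V1), restrict \<kappa> V1, restrict \<kappa> V2)) K
    (SIGMA A:{A. A \<subseteq># M}. K1 A \<times> K2 (M - A))"
  proof (rule bij_betw_byWitness[where f' = "\<lambda>(A, \<kappa>1, \<kappa>2). m \<kappa>1 \<kappa>2"])
    show "\<forall>\<kappa>\<in>K. (case (image_mset \<kappa> (mset_set V1), restrict \<kappa> V1, restrict \<kappa> V2) of
        (A, \<kappa>1, \<kappa>2) \<Rightarrow> m \<kappa>1 \<kappa>2) = \<kappa>"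
      by (auto simp: K_def proper_colorings_def m_def PiE_def extensional_def fun_eq_iff)
    show "\<forall>a\<in>SIGMA A:{A. A \<subseteq># M}. K1 A \<times> K2 (M - A).
       (image_mset (case a of (A, \<kappa>1, \<kappa>2) \<Rightarrow> m \<kappa>1 \<kappa>2) (mset_set V1),
        restrict (case a of (A, \<kappa>1, \<kappa>2) \<Rightarrow> m \<kappa>1 \<kappa>2) V1,
        restrict (case a of (A, \<kappa>1, \<kappa>2) \<Rightarrow> m \<kappa>1 \<kappa>2) V2) = a"
    proof
      fix a assume "a \<in> (SIGMA A:{A. A \<subseteq># M}. K1 A \<times> K2 (M - A))"
      then obtain A \<kappa>1 \<kappa>2 where a: "a = (A, \<kappa>1, \<kappa>2)" and k: "\<kappa>1 \<in> K1 A" "\<kappa>2 \<in> K2 (M - A)"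
        by auto
      have "restrict (m \<kappa>1 \<kappa>2) V1 = \<kappa>1"
        using k by (auto simp: K1_def proper_colorings_def m_def PiE_def extensional_def fun_eq_iff)
      moreover have "restrict (m \<kappa>1 \<kappa>2) V2 = \<kappa>2"
        using k disj by (auto simp: K2_def proper_colorings_def m_def PiE_def extensional_def fun_eq_iff)
      moreover have "image_mset (m \<kappa>1 \<kappa>2) (mset_set V1) = A"
        using k by (simp add: m1 K1_def)
      ultimately show "(image_mset (case a of (A, \<kappa>1, \<kappa>2) \<Rightarrow> m \<kappa>1 \<kappa>2) (mset_set V1),
        restrict (case a of (A, \<kappa>1, \<kappa>2) \<Rightarrow> m \<kappa>1 \<kappa>2) V1,
        restrict (case a of (A, \<kappa>1, \<kappa>2) \<Rightarrow> m \<kappa>1 \<kappa>2) V2) = a" by (simp add: a)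
    qed
    show "(\<lambda>\<kappa>. (image_mset \<kappa> (mset_set V1), restrict \<kappa> V1, restrict \<kappa> V2)) ` K
      \<subseteq> (SIGMA A:{A. A \<subseteq># M}. K1 A \<times> K2 (M - A))"
    proof clarify
      fix \<kappa> assume "\<kappa> \<in> K"
      then have p: "\<forall>u v. {u, v} \<in> E1 \<union> E2 \<longrightarrow> \<kappa> u \<noteq> \<kappa> v"
        and M: "M = image_mset \<kappa> (mset_set V1) + image_mset \<kappa> (mset_set V2)"
        by (auto simp: K_def proper_colorings_def mset_un)
      have "restrict \<kappa> V1 \<in> K1 (image_mset \<kappa> (mset_set V1))"
        using p in1 by (auto simp: K1_def proper_colorings_def restrict1)
      moreover have "restrict \<kappa> V2 \<in> K2 (M - image_mset \<kappa> (mset_set V1))"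
        using p in2 by (auto simp: K2_def proper_colorings_def restrict2 M)
      ultimately show "image_mset \<kappa> (mset_set V1) \<in> {A. A \<subseteq># M} \<and>
        (restrict \<kappa> V1, restrict \<kappa> V2) \<in> K1 (image_mset \<kappa> (mset_set V1)) \<times>
          K2 (M - image_mset \<kappa> (mset_set V1))"
        by (simp add: M)
    qed
    show "(\<lambda>(A, \<kappa>1, \<kappa>2). m \<kappa>1 \<kappa>2) ` (SIGMA A:{A. A \<subseteq># M}. K1 A \<times> K2 (M - A)) \<subseteq> K"
    proof clarify
      fix A \<kappa>1 \<kappa>2 assume k: "A \<subseteq># M" "\<kappa>1 \<in> K1 A" "\<kappa>2 \<in> K2 (M - A)"
      have "image_mset (m \<kappa>1 \<kappa>2) (mset_set (V1 \<union> V2)) = M"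
        using k by (simp add: mset_un m1 m2 K1_def K2_def)
      moreover have "m \<kappa>1 \<kappa>2 \<in> V1 \<union> V2 \<rightarrow>\<^sub>E UNIV"
        using k by (auto simp: m_def K2_def proper_colorings_def PiE_def extensional_def)
      moreover have "m \<kappa>1 \<kappa>2 u \<noteq> m \<kappa>1 \<kappa>2 v" if "{u, v} \<in> E1 \<union> E2" for u v
      proof (cases "{u, v} \<in> E1")
        case True
        then show ?thesis using k in1[OF True] by (simp add: m_def K1_def proper_colorings_def)
      next
        case False
        then have uv: "{u, v} \<in> E2" using that by simp
        then have "u \<notin> V1" "v \<notin> V1" using in2[OF uv] disj by auto
        then show ?thesis using k uv by (simp add: m_def K2_def proper_colorings_def)
      qed
      ultimately show "m \<kappa>1 \<kappa>2 \<in> K" by (simp add: K_def proper_colorings_def)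
    qed
  qed
  then have "card K = card (SIGMA A:{A. A \<subseteq># M}. K1 A \<times> K2 (M - A))"
    by (rule bij_betw_same_card)
  also have "\<dots> = (\<Sum>A | A \<subseteq># M. card (K1 A) * card (K2 (M - A)))"
    using finM finK1 finK2 by (simp add: card_SigmaI card_cartesian_product)
  finally show "chromatic_symfun (V1 \<union> V2) (E1 \<union> E2) M =
      series_mult (chromatic_symfun V1 E1) (chromatic_symfun V2 E2) M"
    by (simp add: chromatic_symfun_def series_mult_def K_def K1_def K2_def)
qed

text \<open>Pulling colorings back along \<open>f\<close> preserves color multisets. This moves
  \<open>star_symfun\<close>, which lives on the vertices \<open>0, ..., k - 1\<close>, to stars
  inside other graphs.\<close>

lemma chromatic_symfun_iso:
  assumes f: "bij_betw f V V'" and fin: "finite V" and E: "\<Union>E \<subseteq> V"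
  shows "chromatic_symfun V' ((`) f ` E) = chromatic_symfun V E"
proof
  fix M
  define K where "K = {\<kappa> \<in> proper_colorings V E. image_mset \<kappa> (mset_set V) = M}"
  define K' where "K' = {\<kappa> \<in> proper_colorings V' ((`) f ` E). image_mset \<kappa> (mset_set V') = M}"
  define f' where "f' = the_inv_into V f"
  have inj: "inj_on f V" and V': "V' = f ` V" using f by (auto simp: bij_betw_def)
  have f'f: "f' (f v) = v" if "v \<in> V" for v
    unfolding f'_def using inj that by (rule the_inv_into_f_f)
  have ms: "mset_set V' = image_mset f (mset_set V)"
    by (simp add: V' image_mset_mset_set[OF inj])
  have "bij_betw (\<lambda>\<kappa>. restrict (\<kappa> \<circ> f) V) K' K"
  proof (rule bij_betw_byWitness[where f' = "\<lambda>\<kappa>. restrict (\<kappa> \<circ> f') V'"])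
    show "\<forall>\<kappa>\<in>K'. restrict (restrict (\<kappa> \<circ> f) V \<circ> f') V' = \<kappa>"
      by (auto simp: K'_def proper_colorings_def fun_eq_iff V' f'f PiE_def extensional_def)
    show "\<forall>\<kappa>\<in>K. restrict (restrict (\<kappa> \<circ> f') V' \<circ> f) V = \<kappa>"
      by (auto simp: K_def proper_colorings_def fun_eq_iff V' f'f PiE_def extensional_def)
    show "(\<lambda>\<kappa>. restrict (\<kappa> \<circ> f) V) ` K' \<subseteq> K"
    proof clarify
      fix \<kappa> assume k: "\<kappa> \<in> K'"
      have "image_mset (restrict (\<kappa> \<circ> f) V) (mset_set V) = image_mset (\<kappa> \<circ> f) (mset_set V)"
        using fin by (intro image_mset_cong) auto
      also have "\<dots> = M" using k by (simp add: K'_def ms image_mset.compositionality)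
      finally have "image_mset (restrict (\<kappa> \<circ> f) V) (mset_set V) = M" .
      moreover have "\<kappa> (f u) \<noteq> \<kappa> (f v)" if "{u, v} \<in> E" for u v
      proof -
        have "{f u, f v} \<in> (`) f ` E" using that by (auto intro: image_eqI[of _ _ "{u, v}"])
        then show ?thesis using k by (auto simp: K'_def proper_colorings_def)
      qed
      moreover have "u \<in> V \<and> v \<in> V" if "{u, v} \<in> E" for u v using that E by blast
      ultimately show "restrict (\<kappa> \<circ> f) V \<in> K"
        by (simp add: K_def proper_colorings_def)
    qed
    show "(\<lambda>\<kappa>. restrict (\<kappa> \<circ> f') V') ` K \<subseteq> K'"
    proof clarify
      fix \<kappa> assume k: "\<kappa> \<in> K"
      have "image_mset (restrict (\<kappa> \<circ> f') V') (mset_set V') = image_mset \<kappa> (mset_set V)"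
        unfolding ms image_mset.compositionality
        using fin by (intro image_mset_cong) (auto simp: V' f'f)
      also have "\<dots> = M" using k by (simp add: K_def)
      finally have "image_mset (restrict (\<kappa> \<circ> f') V') (mset_set V') = M" .
      moreover have "u \<in> V' \<and> v \<in> V' \<and> \<kappa> (f' u) \<noteq> \<kappa> (f' v)" if uv: "{u, v} \<in> (`) f ` E" for u v
      proof -
        obtain e where e: "e \<in> E" "{u, v} = f ` e" using uv by auto
        have "e \<subseteq> V" using e E by auto
        moreover obtain a b where ab: "a \<in> e" "b \<in> e" "u = f a" "v = f b" using e(2) by blast
        \<comment> \<open>Since \<open>f\<close> is injective, the preimage of the possibly
          degenerate pair \<open>{u, v}\<close> has no further elements.\<close>
        moreover have "e = {a, b}"
        proof -
          have "x \<in> {a, b}" if "x \<in> e" for x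
          proof -
            have "f x = f a \<or> f x = f b" using e(2) that ab by blast
            then show ?thesis using inj ab \<open>e \<subseteq> V\<close> that by (auto dest: inj_onD)
          qed
          then show ?thesis using ab by auto
        qed
        ultimately show ?thesis using k e(1) by (auto simp: K_def proper_colorings_def V' f'f)
      qed
      ultimately show "restrict (\<kappa> \<circ> f') V' \<in> K'"
        by (simp add: K'_def proper_colorings_def)
    qed
  qed
  then show "chromatic_symfun V' ((`) f ` E) M = chromatic_symfun V E M"
    by (simp add: chromatic_symfun_def K_def K'_def bij_betw_same_card)
qed

lemma star_symfun_star:
  assumes fin: "finite X" and u: "u \<notin> X"
  shows "chromatic_symfun (insert u X) {{v, u} | v. v \<in> X} = star_symfun (Suc (card X))"
proof -
  obtain f where f: "bij_betw f {1..<Suc (card X)} X"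
    using ex_bij_betw_nat_finite_1[OF fin] by (auto simp: atLeastLessThanSuc_atLeastAtMost)
  define f' where "f' = f(0 := u)"
  have "bij_betw f' {1..<Suc (card X)} X \<longleftrightarrow> bij_betw f {1..<Suc (card X)} X"
    by (rule bij_betw_cong) (auto simp: f'_def)
  then have "bij_betw f' {1..<Suc (card X)} X" using f by simp
  moreover have "bij_betw f' {0} {u}" by (simp add: f'_def)
  ultimately have "bij_betw f' ({0} \<union> {1..<Suc (card X)}) ({u} \<union> X)"
    using u by (intro bij_betw_combine) auto
  moreover have "{0} \<union> {1..<Suc (card X)} = {0..<Suc (card X)}" by auto
  ultimately have bij: "bij_betw f' {0..<Suc (card X)} (insert u X)" by simp
  have "star_edges (Suc (card X)) = (\<lambda>i. {0, i}) ` {1..<Suc (card X)}"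
    by (auto simp: star_edges_def)
  then have "(`) f' ` star_edges (Suc (card X)) = (\<lambda>i. {u, f i}) ` {1..<Suc (card X)}"
    by (simp add: image_image f'_def insert_commute cong: image_cong_simp)
  also have "\<dots> = (\<lambda>v. {v, u}) ` f ` {1..<Suc (card X)}"
    by (simp add: image_image insert_commute)
  also have "f ` {1..<Suc (card X)} = X" using f by (simp add: bij_betw_def)
  finally have "(`) f' ` star_edges (Suc (card X)) = {{v, u} | v. v \<in> X}" by auto
  moreover have "\<Union>(star_edges (Suc (card X))) \<subseteq> {0..<Suc (card X)}"
    by (auto simp: star_edges_def)
  ultimately show ?thesis
    using chromatic_symfun_iso[OF bij, of "star_edges (Suc (card X))"] by (simp add: star_symfun_def)
qed

text \<open>Induction over the star sizes, splitting off one star as a disjoint factor each time.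
  Only the multiset of \<open>ps\<close> is fixed, so some center has a star of the size
  \<open>k\<close> at the head of the list.\<close>

lemma chromatic_symfun_star_forest:
  assumes "finite V" "Y \<subseteq> V" "g ` Y \<subseteq> V - Y"
    and "mset ps = image_mset (\<lambda>u. Suc (card {v \<in> Y. g v = u})) (mset_set (V - Y))"
  shows "chromatic_symfun V {{v, g v} | v. v \<in> Y} = star_product ps"
  using assms
proof (induction ps arbitrary: V Y)
  case Nil
  then have "V - Y = {}" by (simp add: mset_set_empty_iff)
  then have [simp]: "V = {}" "Y = {}" using Nil.prems by auto
  show ?case
    by (auto simp: star_product_def chromatic_symfun_def proper_colorings_def series_one_def)
next
  case (Cons k ps)
  let ?s = "\<lambda>u. Suc (card {v \<in> Y. g v = u})"
  have "k \<in># image_mset ?s (mset_set (V - Y))" using Cons.prems(4)[symmetric] by simp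
  then obtain u where u: "u \<in> V - Y" "k = ?s u" using Cons.prems(1) by auto
  define X where "X = {v \<in> Y. g v = u}"
  define V2 where "V2 = V - insert u X"
  define Y2 where "Y2 = Y - X"
  have finX: "finite X" "u \<notin> X" using Cons.prems(1,2) u by (auto simp: X_def intro: finite_subset)
  have dec: "V - Y = insert u (V2 - Y2)" "u \<notin> V2 - Y2"
    using u Cons.prems(2) by (auto simp: V2_def Y2_def X_def)
  have fin2: "finite (V2 - Y2)" "finite V2" using Cons.prems(1) by (auto simp: V2_def)
  have "mset ps = image_mset ?s (mset_set (V2 - Y2))"
    using Cons.prems(4) u(2) fin2 dec by simp
  also have "\<dots> = image_mset (\<lambda>u. Suc (card {v \<in> Y2. g v = u})) (mset_set (V2 - Y2))"
  proof (rule image_mset_cong)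
    fix w assume "w \<in># mset_set (V2 - Y2)"
    then have "w \<noteq> u" using fin2 dec by auto
    then have "{v \<in> Y. g v = w} = {v \<in> Y2. g v = w}" by (auto simp: Y2_def X_def)
    then show "?s w = Suc (card {v \<in> Y2. g v = w})" by simp
  qed
  finally have ps: "mset ps = image_mset (\<lambda>u. Suc (card {v \<in> Y2. g v = u})) (mset_set (V2 - Y2))" .
  have sub: "Y2 \<subseteq> V2" "g ` Y2 \<subseteq> V2 - Y2"
    using Cons.prems(2,3) u by (auto simp: Y2_def V2_def X_def)
  have IH: "chromatic_symfun V2 {{v, g v} | v. v \<in> Y2} = star_product ps"
    by (rule Cons.IH[OF fin2(2) sub ps])
  have "V = insert u X \<union> V2" using u Cons.prems(2) by (auto simp: V2_def X_def)
  moreover have "{{v, g v} | v. v \<in> Y} = {{v, u} | v. v \<in> X} \<union> {{v, g v} | v. v \<in> Y2}"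
    by (auto simp: X_def Y2_def)
  moreover have "chromatic_symfun (insert u X \<union> V2) ({{v, u} | v. v \<in> X} \<union> {{v, g v} | v. v \<in> Y2}) =
    series_mult (chromatic_symfun (insert u X) {{v, u} | v. v \<in> X})
      (chromatic_symfun V2 {{v, g v} | v. v \<in> Y2})"
    using finX fin2 sub by (intro chromatic_symfun_disjoint_union) (auto simp: V2_def)
  ultimately show ?case
    using IH star_symfun_star[OF finX] u(2) by (simp add: star_product_def X_def)
qed

section \<open>Uniqueness of the star expansion\<close>

lemma sum_Pow_insert:
  assumes "finite A" "x \<notin> A"
  shows "(\<Sum>S\<in>Pow (insert x A). f S) = (\<Sum>S\<in>Pow A. f S + f (insert x S))"
proof -
  have inj: "inj_on (insert x) (Pow A)" using assms by (auto simp: inj_on_def)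
  have disj: "Pow A \<inter> insert x ` Pow A = {}" using assms by auto
  show ?thesis
    unfolding Pow_insert using assms disj
    by (subst sum.union_disjoint) (simp_all only: sum.reindex[OF inj] o_def finite_Pow_iff finite_imageI sum.distrib)
qed

text \<open>This expands the product of the factors \<open>1 - of_bool (P a)\<close> over
  \<open>a\<close> in \<open>A\<close>.\<close>

lemma of_bool_none_eq_sum:
  assumes "finite A"
  shows "(of_bool (\<forall>a\<in>A. \<not> P a) :: 'b::comm_ring_1) =
    (\<Sum>S\<in>Pow A. (- 1) ^ card S * of_bool (\<forall>a\<in>S. P a))"
  using assms
proof induction
  case empty
  then show ?case by simp
next
  case (insert x A)
  have fin: "finite S" "x \<notin> S" if "S \<in> Pow A" for S
    using that insert.hyps by (auto intro: finite_subset)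
  have "(\<Sum>S\<in>Pow (insert x A). (- 1) ^ card S * of_bool (\<forall>a\<in>S. P a) :: 'b) =
    (\<Sum>S\<in>Pow A. (- 1) ^ card S * of_bool (\<forall>a\<in>S. P a)) +
    (\<Sum>S\<in>Pow A. (- 1) ^ card (insert x S) * of_bool (\<forall>a\<in>insert x S. P a))"
    unfolding sum_Pow_insert[OF insert.hyps] by (rule sum.distrib)
  also have "(\<Sum>S\<in>Pow A. (- 1) ^ card (insert x S) * of_bool (\<forall>a\<in>insert x S. P a)) =
    (\<Sum>S\<in>Pow A. - of_bool (P x) * ((- 1) ^ card S * of_bool (\<forall>a\<in>S. P a)) :: 'b)"
    using fin by (intro sum.cong refl) (simp add: card_insert_if)
  also have "\<dots> = - of_bool (P x) * of_bool (\<forall>a\<in>A. \<not> P a)"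
    by (simp only: insert.IH sum_distrib_left)
  finally show ?case by (simp add: insert.IH[symmetric] del: Pow_insert)
qed

lemma sum_fun_apply: "(\<Sum>i\<in>I. f i) x = (\<Sum>i\<in>I. f i x :: 'b::comm_monoid_add)"
  by (induction I rule: infinite_finite_induct) (auto simp: plus_fun_def)

section \<open>Independence by counting dimensions\<close>

context vector_space
begin

text \<open>A nontrivial relation among the \<open>s i\<close> would make one of them redundant, so
  the independent family \<open>q\<close> would lie in the span of fewer than \<open>card I\<close>
  vectors.\<close>

lemma independent_family_of_span:
  fixes s q :: "'i \<Rightarrow> 'b"
  assumes fin: "finite I"
    and indep: "\<And>d. (\<Sum>i\<in>I. scale (d i) (q i)) = 0 \<Longrightarrow> \<forall>i\<in>I. d i = 0"
    and span: "\<And>i. i \<in> I \<Longrightarrow> q i \<in> span (s ` I)"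
    and zero: "(\<Sum>i\<in>I. scale (c i) (s i)) = 0"
  shows "\<forall>i\<in>I. c i = 0"
proof (rule ccontr)
  assume "\<not> (\<forall>i\<in>I. c i = 0)"
  then obtain k where k: "k \<in> I" "c k \<noteq> 0" by blast
  have inj: "inj_on q I"
  proof (rule inj_onI, rule ccontr)
    fix i j assume ij: "i \<in> I" "j \<in> I" "q i = q j" "i \<noteq> j"
    \<comment> \<open>The relation \<open>q i - q j = 0\<close>, contradicting
      \<open>indep\<close>.\<close>
    define d where "d x = (if x = i then 1 else if x = j then - 1 else 0 :: 'a)" for x
    have "(\<Sum>x\<in>I. scale (d x) (q x)) = (\<Sum>x\<in>{i, j}. scale (d x) (q x))"
      using fin ij by (intro sum.mono_neutral_right) (auto simp: d_def)
    also have "\<dots> = 0" using ij by (simp add: d_def)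
    finally have "d i = 0" using indep ij by blast
    then show False by (simp add: d_def)
  qed
  have ind: "independent (q ` I)"
  proof
    assume "dependent (q ` I)"
    then obtain u where u: "\<exists>v\<in>q ` I. u v \<noteq> 0" "(\<Sum>v\<in>q ` I. scale (u v) v) = 0"
      using dependent_finite[of "q ` I"] fin by auto
    have "(\<Sum>i\<in>I. scale (u (q i)) (q i)) = 0"
      using u(2) by (simp add: sum.reindex[OF inj])
    from indep[OF this] u(1) show False by auto
  qed
  have "scale (c k) (s k) = - (\<Sum>i\<in>I - {k}. scale (c i) (s i))"
    using zero k(1) fin by (simp add: sum.remove eq_neg_iff_add_eq_0)
  also have "\<dots> \<in> span (s ` (I - {k}))"
    by (intro span_neg span_sum span_scale span_base) auto
  finally have "scale (inverse (c k)) (scale (c k) (s k)) \<in> span (s ` (I - {k}))"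
    by (rule span_scale)
  then have "s k \<in> span (s ` (I - {k}))" using k(2) by simp
  then have "s ` I \<subseteq> span (s ` (I - {k}))" by (auto intro: span_base)
  then have "span (s ` I) \<subseteq> span (s ` (I - {k}))" by (rule span_minimal) simp
  then have "q ` I \<subseteq> span (s ` (I - {k}))" using span by auto
  then have "card (q ` I) \<le> card (s ` (I - {k}))"
    using independent_span_bound[of "s ` (I - {k})" "q ` I"] ind fin by simp
  also have "\<dots> \<le> card (I - {k})" using fin by (intro card_image_le) auto
  also have "\<dots> < card I" using fin k(1) by (rule card_Diff1_less)
  finally show False using inj by (simp add: card_image)
qed

end

interpretation series: vector_space "\<lambda>(c::rat) (f::series) M. c * f M"
  by unfold_locales (auto simp: fun_eq_iff plus_fun_def algebra_simps)

section \<open>Partitions as multisets, and star forests realizing them\<close>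

definition partition_of :: "nat multiset \<Rightarrow> nat list" where
  "partition_of T = rev (sorted_list_of_multiset T)"

lemma mset_partition_of [simp]: "mset (partition_of T) = T"
  by (simp add: partition_of_def)

lemma partition_of_in_partitions:
  assumes "0 \<notin># T" "sum_mset T = n"
  shows "partition_of T \<in> partitions n"
proof -
  have "sum_list (partition_of T) = n"
    using assms(2) by (metis mset_partition_of sum_mset_sum_list)
  moreover have "\<forall>k\<in>set (partition_of T). k > 0"
    using assms(1) by (auto simp: partition_of_def intro: Nat.gr0I)
  ultimately show ?thesis
    by (simp add: partitions_def partition_of_def sorted_wrt_rev)
qed

lemma partition_of_mset:
  assumes "ps \<in> partitions n"
  shows "partition_of (mset ps) = ps"
proof -
  have "sorted (rev ps)" using assms by (simp add: partitions_def sorted_wrt_rev)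
  then have "sort ps = rev ps" by (metis properties_for_sort mset_rev)
  then show ?thesis by (simp add: partition_of_def)
qed

lemma length_partition_le:
  assumes "ps \<in> partitions n"
  shows "length ps \<le> n"
proof -
  have "length ps \<le> sum_list ps" if "\<forall>k\<in>set ps. k > 0" for ps :: "nat list"
    using that by (induction ps) (auto simp: Suc_le_eq add_strict_mono)
  then show ?thesis using assms by (auto simp: partitions_def)
qed

lemma finite_partitions: "finite (partitions n)"
proof (rule finite_subset)
  show "partitions n \<subseteq> {ps. set ps \<subseteq> {..n} \<and> length ps \<le> n}"
    using length_partition_le by (auto simp: partitions_def member_le_sum_list)
qed (simp add: finite_lists_length_le)

lemma star_forest_sum:
  assumes "finite V"
  shows "chromatic_symfun V {{v, g v} | v. v \<in> B} M =
    (\<Sum>\<kappa>\<in>colorings_with V M. of_bool (\<forall>v\<in>B. \<kappa> v \<noteq> \<kappa> (g v)))"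
proof -
  have "(\<forall>u v. {u, v} \<in> {{v, g v} | v. v \<in> B} \<longrightarrow> \<kappa> u \<noteq> \<kappa> v) \<longleftrightarrow> (\<forall>v\<in>B. \<kappa> v \<noteq> \<kappa> (g v))"
    for \<kappa> :: "'a \<Rightarrow> nat"
    by (auto simp: doubleton_eq_iff)
  then show ?thesis by (simp only: chromatic_symfun_sum[OF assms])
qed

text \<open>The component sizes of the star forest with centers \<open>V - Y\<close> in which every \<open>v \<in> Y\<close> is a leaf
  attached to \<open>g v\<close>.\<close>

definition star_type :: "'a set \<Rightarrow> 'a set \<Rightarrow> ('a \<Rightarrow> 'a) \<Rightarrow> nat multiset" where
  "star_type V Y g = image_mset (\<lambda>u. Suc (card {v \<in> Y. g v = u})) (mset_set (V - Y))"

text \<open>Every vertex is counted once: a center by the \<open>Suc\<close>, a leaf in the fibre of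
  \<open>g\<close> over its center.\<close>

lemma partition_of_star_type:
  assumes "finite V" "Y \<subseteq> V" "g ` Y \<subseteq> V - Y"
  shows "partition_of (star_type V Y g) \<in> partitions (card V)"
proof (rule partition_of_in_partitions)
  have fin: "finite Y" using assms by (auto intro: finite_subset)
  have "card Y = (\<Sum>u\<in>V - Y. card {v \<in> Y. g v = u})"
  proof -
    have "card Y = card (\<Union>u\<in>V - Y. {v \<in> Y. g v = u})"
      using assms(3) by (intro arg_cong[where f = card]) auto
    also have "\<dots> = (\<Sum>u\<in>V - Y. card {v \<in> Y. g v = u})"
      using assms(1) fin by (intro card_UN_disjoint) auto
    finally show ?thesis .
  qed
  then have "sum_mset (star_type V Y g) = card (V - Y) + card Y"
    by (simp add: star_type_def sum_unfold_sum_mset[symmetric] sum_Suc)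
  then show "sum_mset (star_type V Y g) = card V"
    using assms fin by (simp add: card_Diff_subset card_mono)
qed (auto simp: star_type_def)

lemma chromatic_symfun_star_type:
  assumes "finite V" "Y \<subseteq> V" "g ` Y \<subseteq> V - Y"
  shows "chromatic_symfun V {{v, g v} | v. v \<in> Y} = star_product (partition_of (star_type V Y g))"
  using assms by (intro chromatic_symfun_star_forest) (auto simp: star_type_def)

text \<open>Each part gets its own block of consecutive vertices.\<close>

lemma star_type_exists:
  assumes "\<forall>k\<in>set ps. k > 0"
  shows "\<exists>Y g. Y \<subseteq> {0..<sum_list ps} \<and> g ` Y \<subseteq> {0..<sum_list ps} - Y \<and>
    star_type {0..<sum_list ps} Y g = mset ps"
  using assms
proof (induction ps)
  case Nil
  then show ?case by (auto simp: star_type_def)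
next
  case (Cons k ps)
  define n where "n = sum_list ps"
  obtain Y g where Yg: "Y \<subseteq> {0..<n}" "g ` Y \<subseteq> {0..<n} - Y" "star_type {0..<n} Y g = mset ps"
    using Cons by (auto simp: n_def)
  \<comment> \<open>The new block is \<open>n, ..., n + k - 1\<close>. Its first vertex is the
    center, so the leaves start at \<open>Suc n\<close>.\<close>
  define Y' where "Y' = Y \<union> {Suc n..<n + k}"
  define g' where "g' v = (if v < n then g v else n)" for v
  have k: "k > 0" using Cons.prems by simp
  have Y_less: "v < n" "g v < n" "g v \<notin> Y" if "v \<in> Y" for v using Yg that by auto
  have eq: "{0..<n + k} - Y' = insert n ({0..<n} - Y)"
    using Yg(1) k by (auto simp: Y'_def)
  have "{v \<in> Y'. g' v = n} = {Suc n..<n + k}"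
    using Y_less by (auto simp: Y'_def g'_def)
  then have "Suc (card {v \<in> Y'. g' v = n}) = k" using k by simp
  moreover have "{v \<in> Y'. g' v = u} = {v \<in> Y. g v = u}" if "u \<in> {0..<n} - Y" for u
    using Y_less that by (auto simp: Y'_def g'_def)
  then have "image_mset (\<lambda>u. Suc (card {v \<in> Y'. g' v = u})) (mset_set ({0..<n} - Y)) = mset ps"
    unfolding Yg(3)[symmetric] star_type_def by (intro image_mset_cong) simp
  ultimately have "star_type {0..<n + k} Y' g' = mset (k # ps)"
    unfolding star_type_def eq by simp
  moreover have "Y' \<subseteq> {0..<n + k}" using Yg(1) by (auto simp: Y'_def)
  moreover have "g' ` Y' \<subseteq> {0..<n + k} - Y'" using Y_less k unfolding eq by (auto simp: Y'_def g'_def)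
  ultimately show ?case by (intro exI[of _ Y'] exI[of _ g']) (simp add: n_def add.commute)
qed

text \<open>The multiset of nonzero exponents of a monomial, which is the monomial up to renaming
  variables.\<close>

definition shape :: "'a multiset \<Rightarrow> nat multiset" where
  "shape M = image_mset (count M) (mset_set (set_mset M))"

lemma shape_image_mset:
  assumes "inj_on f (set_mset M)"
  shows "shape (image_mset f M) = shape M"
proof -
  have "count (image_mset f M) (f x) = count M x" if "x \<in># M" for x
  proof -
    have "f -` {f x} \<inter> set_mset M = {x}" using assms that by (auto dest: inj_onD)
    then show ?thesis by (simp add: count_image_mset)
  qed
  moreover have "mset_set (f ` set_mset M) = image_mset f (mset_set (set_mset M))"
    by (simp add: image_mset_mset_set[OF assms])
  ultimately show ?thesis
    by (simp add: shape_def image_mset.compositionality) (rule image_mset_cong, simp)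
qed

text \<open>The series \<open>q ps\<close> is the power sum of \<open>ps\<close>, counting colorings that are constant on every star.
  The power sums lie in the span of the star products, and they are independent because the
  coefficient of the monomial \<open>m \<rho>\<close> in \<open>q ps\<close> vanishes if \<open>ps \<noteq> \<rho>\<close> is not longer than \<open>\<rho>\<close>. Hence
  equally many star products are independent as well.\<close>

lemma star_products_independent:
  assumes zero: "\<And>M. (\<Sum>ps\<in>partitions n. c ps * star_product ps M) = 0"
  shows "\<forall>ps\<in>partitions n. c ps = 0"
proof -
  let ?V = "{0..<n}"
  have "\<forall>ps\<in>partitions n. \<exists>Y g. Y \<subseteq> ?V \<and> g ` Y \<subseteq> ?V - Y \<and> star_type ?V Y g = mset ps"
    using star_type_exists by (fastforce simp: partitions_def)
  then obtain Y g where Yg: "\<And>ps. ps \<in> partitions n \<Longrightarrow>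
      Y ps \<subseteq> ?V \<and> g ps ` Y ps \<subseteq> ?V - Y ps \<and> star_type ?V (Y ps) (g ps) = mset ps"
    by metis
  define q :: "nat list \<Rightarrow> series" where "q ps M = (\<Sum>\<kappa>\<in>colorings_with ?V M.
    of_bool (\<forall>v\<in>Y ps. \<not> \<kappa> v \<noteq> \<kappa> (g ps v)))" for ps M
  show ?thesis
  proof (rule series.independent_family_of_span[where q = q and s = star_product])
    show "finite (partitions n)" by (rule finite_partitions)
    show "(\<Sum>i\<in>partitions n. (\<lambda>M. c i * star_product i M)) = 0"
      using zero by (simp add: fun_eq_iff sum_fun_apply)
  next
    fix ps assume ps: "ps \<in> partitions n"
    then have fin: "finite (Y ps)" using Yg by (auto intro: finite_subset)
    \<comment> \<open>Inclusion-exclusion over the leaves: a set \<open>B\<close> of leaves that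
      stay attached, with all other leaves turned into isolated centers, is again a star
      forest.\<close>
    have "q ps M = (\<Sum>B\<in>Pow (Y ps). (- 1) ^ card B * star_product (partition_of (star_type ?V B (g ps))) M)" for M
    proof -
      have "q ps M = (\<Sum>B\<in>Pow (Y ps). (- 1) ^ card B *
          (\<Sum>\<kappa>\<in>colorings_with ?V M. of_bool (\<forall>v\<in>B. \<kappa> v \<noteq> \<kappa> (g ps v))))"
        unfolding q_def of_bool_none_eq_sum[OF fin] sum_distrib_left by (rule sum.swap)
      also have "\<dots> = (\<Sum>B\<in>Pow (Y ps). (- 1) ^ card B * star_product (partition_of (star_type ?V B (g ps))) M)"
      proof (intro sum.cong refl arg_cong2[where f = "(*)"])
        fix B assume "B \<in> Pow (Y ps)"
        then have B: "B \<subseteq> ?V" "g ps ` B \<subseteq> ?V - B" using Yg[OF ps] by auto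
        show "(\<Sum>\<kappa>\<in>colorings_with ?V M. of_bool (\<forall>v\<in>B. \<kappa> v \<noteq> \<kappa> (g ps v))) =
          star_product (partition_of (star_type ?V B (g ps))) M"
          unfolding chromatic_symfun_star_type[OF _ B, simplified, symmetric]
          by (rule star_forest_sum[symmetric]) simp
      qed
      finally show ?thesis .
    qed
    then have "q ps = (\<Sum>B\<in>Pow (Y ps). (\<lambda>M. (- 1) ^ card B * star_product (partition_of (star_type ?V B (g ps))) M))"
      by (simp add: fun_eq_iff sum_fun_apply)
    also have "\<dots> \<in> series.span (star_product ` partitions n)"
    proof (intro series.span_sum series.span_scale series.span_base imageI)
      fix B assume "B \<in> Pow (Y ps)"
      then have "B \<subseteq> ?V" "g ps ` B \<subseteq> ?V - B" using Yg[OF ps] by auto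
      then show "partition_of (star_type ?V B (g ps)) \<in> partitions n"
        using partition_of_star_type[of ?V B "g ps"] by simp
    qed
    finally show "q ps \<in> series.span (star_product ` partitions n)" .
  next
    fix d assume "(\<Sum>i\<in>partitions n. (\<lambda>M. d i * q i M)) = 0"
    then have d0: "(\<Sum>ps\<in>partitions n. d ps * q ps M) = 0" for M
      by (auto dest: fun_cong[where x = M] simp: sum_fun_apply)
    show "\<forall>ps\<in>partitions n. d ps = 0"
    proof (rule ccontr)
      assume "\<not> ?thesis"
      \<comment> \<open>Among the partitions with nonzero coefficient a longest one,
        \<open>\<rho>\<close>, is chosen; the coefficient of \<open>m \<rho>\<close> will isolate
        \<open>d \<rho>\<close>.\<close>
      then obtain \<rho>' where "\<rho>' \<in> partitions n \<and> d \<rho>' \<noteq> 0" by blast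
      then have "\<exists>\<rho>. (\<rho> \<in> partitions n \<and> d \<rho> \<noteq> 0) \<and>
        (\<forall>ps. ps \<in> partitions n \<and> d ps \<noteq> 0 \<longrightarrow> length ps \<le> length \<rho>)"
        by (rule ex_has_greatest_nat[where b = "Suc n"]) (simp add: length_partition_le less_Suc_eq_le)
      then obtain \<rho> where \<rho>: "\<rho> \<in> partitions n" "d \<rho> \<noteq> 0"
        and max: "\<And>ps. ps \<in> partitions n \<Longrightarrow> d ps \<noteq> 0 \<Longrightarrow> length ps \<le> length \<rho>"
        by blast
      \<comment> \<open>\<open>r ps\<close> sends every vertex to the center of its star. As a
        coloring it has the monomial \<open>m ps\<close>, whose variables are the centers and whose
        exponents are the star sizes.\<close>
      define r where "r ps v = (if v \<in> Y ps then g ps v else v)" for ps v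
      define m where "m ps = image_mset (r ps) (mset_set ?V)" for ps
      have set_m: "set_mset (m ps) = ?V - Y ps" if "ps \<in> partitions n" for ps
        using Yg[OF that] by (force simp: m_def r_def)
      have shape_m: "shape (m ps) = mset ps" if ps: "ps \<in> partitions n" for ps
      proof -
        have "count (m ps) u = Suc (card {v \<in> Y ps. g ps v = u})" if u: "u \<in> ?V - Y ps" for u
        proof -
          have "r ps -` {u} \<inter> ?V = insert u {v \<in> Y ps. g ps v = u}"
            using Yg[OF ps] u by (auto simp: r_def split: if_splits)
          moreover have "finite (Y ps)" using Yg[OF ps] by (auto intro: finite_subset)
          moreover have "(\<Sum>v | v \<in> Y ps \<and> g ps v = u. count (mset_set ?V) v) =
              (\<Sum>v | v \<in> Y ps \<and> g ps v = u. 1)"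
            using Yg[OF ps] by (intro sum.cong refl) auto
          ultimately show ?thesis using u by (simp add: m_def count_image_mset)
        qed
        then have "shape (m ps) = star_type ?V (Y ps) (g ps)"
          unfolding shape_def set_m[OF ps] star_type_def by (intro image_mset_cong) auto
        then show ?thesis using Yg[OF ps] by simp
      qed
      have card_m: "card (set_mset (m ps)) = length ps" if "ps \<in> partitions n" for ps
        using arg_cong[OF shape_m[OF that], of size] by (simp add: shape_def)
      \<comment> \<open>Such a \<open>\<kappa>\<close> maps the \<open>length ps\<close> centers
        onto the \<open>length \<rho>\<close> variables of \<open>m \<rho>\<close>. As
        \<open>\<rho>\<close> is longest, it is injective on the centers, so the two monomials have
        the same exponents.\<close>
      have key: "ps = \<rho>" if ps: "ps \<in> partitions n" "d ps \<noteq> 0"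
        and k: "\<kappa> \<in> colorings_with ?V (m \<rho>)" "\<forall>v\<in>Y ps. \<kappa> v = \<kappa> (g ps v)" for ps \<kappa>
      proof -
        have "image_mset \<kappa> (m ps) = image_mset \<kappa> (mset_set ?V)"
          unfolding m_def image_mset.compositionality
          using k(2) by (intro image_mset_cong) (auto simp: r_def)
        then have im: "image_mset \<kappa> (m ps) = m \<rho>" using k(1) by (simp add: colorings_with_def)
        then have "\<kappa> ` set_mset (m ps) = set_mset (m \<rho>)" by (metis set_image_mset)
        then have "card (\<kappa> ` set_mset (m ps)) = length \<rho>" using card_m \<rho>(1) by simp
        moreover have "card (\<kappa> ` set_mset (m ps)) \<le> card (set_mset (m ps))" by (rule card_image_le) simp
        ultimately have "card (\<kappa> ` set_mset (m ps)) = card (set_mset (m ps))"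
          using max[OF ps] card_m[OF ps(1)] by simp
        then have "inj_on \<kappa> (set_mset (m ps))" by (intro eq_card_imp_inj_on) auto
        then have "shape (m \<rho>) = shape (m ps)" using shape_image_mset im by metis
        then have "mset \<rho> = mset ps" using shape_m ps \<rho> by simp
        then show ?thesis using partition_of_mset ps \<rho> by metis
      qed
      have "d ps * q ps (m \<rho>) = 0" if "ps \<in> partitions n - {\<rho>}" for ps
      proof (cases "d ps = 0")
        case False
        then have "q ps (m \<rho>) = 0"
          unfolding q_def using key[of ps] that by (intro sum.neutral) auto
        then show ?thesis by simp
      qed simp
      then have "(\<Sum>ps\<in>partitions n - {\<rho>}. d ps * q ps (m \<rho>)) = 0"
        by (rule sum.neutral[OF ballI])
      then have "(\<Sum>ps\<in>partitions n. d ps * q ps (m \<rho>)) = d \<rho> * q \<rho> (m \<rho>)"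
        using \<rho> finite_partitions[of n] by (simp add: sum.remove)
      then have "q \<rho> (m \<rho>) = 0" using d0 \<rho>(2) by simp
      \<comment> \<open>Coloring every vertex by the center of its own star contributes to
        \<open>q \<rho> (m \<rho>)\<close>, so this count is positive.\<close>
      moreover have "restrict (r \<rho>) ?V \<in> colorings_with ?V (m \<rho>)"
        unfolding colorings_with_def m_def by (auto intro!: image_mset_cong)
      moreover have "restrict (r \<rho>) ?V v = restrict (r \<rho>) ?V (g \<rho> v)" if "v \<in> Y \<rho>" for v
        using Yg[OF \<rho>(1)] that by (force simp: r_def)
      ultimately show False
        unfolding q_def using finite_colorings_with[of ?V "m \<rho>"] by (auto simp: sum_nonneg_eq_0_iff)
    qed
  qed
qed

text \<open>Independence of the star products, with the value 0 outside \<open>partitions n\<close>,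
  makes the \<open>THE\<close> in \<open>star_coeffs\<close> well defined; any explicit expansion
  then yields the coefficients.\<close>

lemma star_coeffs_eq:
  assumes "star_expansion n f c"
  shows "star_coeffs n f = c"
  unfolding star_coeffs_def
proof (rule the_equality)
  fix c' assume c': "star_expansion n f c'"
  have "(\<Sum>ps\<in>partitions n. c' ps * star_product ps M) = (\<Sum>ps\<in>partitions n. c ps * star_product ps M)" for M
    using assms c' unfolding star_expansion_def by metis
  then have "(\<Sum>ps\<in>partitions n. (c' ps - c ps) * star_product ps M) = 0" for M
    by (simp add: algebra_simps sum_subtractf)
  then have "\<forall>ps\<in>partitions n. c' ps - c ps = 0" by (rule star_products_independent)
  then have "c' ps = c ps" for ps
    using assms c' by (cases "ps \<in> partitions n") (auto simp: star_expansion_def)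
  then show "c' = c" by blast
qed (rule assms)

section \<open>Signed sums over separating edge sets\<close>

definition conn :: "'a set set \<Rightarrow> 'a \<Rightarrow> 'a \<Rightarrow> bool" where
  "conn C x y \<longleftrightarrow> (x, y) \<in> (adj_rel C)\<^sup>*"

lemma conn_refl [simp]: "conn C x x"
  by (simp add: conn_def)

lemma conn_trans: "conn C x y \<Longrightarrow> conn C y z \<Longrightarrow> conn C x z"
  by (simp add: conn_def)

lemma conn_sym: "conn C x y \<Longrightarrow> conn C y x"
proof -
  have "sym (adj_rel C)" by (auto simp: sym_def adj_rel_def insert_commute)
  then show "conn C x y \<Longrightarrow> conn C y x" unfolding conn_def by (metis sym_rtrancl symD)
qed

lemma conn_edge: "{x, y} \<in> C \<Longrightarrow> conn C x y"
  by (auto simp: conn_def adj_rel_def)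

lemma conn_mono: "conn C x y \<Longrightarrow> C \<subseteq> D \<Longrightarrow> conn D x y"
  unfolding conn_def by (erule rtrancl_mono[THEN subsetD, rotated]) (auto simp: adj_rel_def)

lemma conn_empty [simp]: "conn {} x y \<longleftrightarrow> x = y"
  by (simp add: conn_def adj_rel_def)

lemma conn_induct [consumes 1, case_names refl step]:
  assumes "conn C x y" "P x" "\<And>y z. conn C x y \<Longrightarrow> {y, z} \<in> C \<Longrightarrow> P y \<Longrightarrow> P z"
  shows "P y"
  using assms(1) unfolding conn_def
  by (induction rule: rtrancl_induct) (use assms(2,3) in \<open>auto simp: conn_def adj_rel_def\<close>)

text \<open>A further crossing of the new edge ends in a vertex that is already reached with at most
  one crossing.\<close>

lemma conn_insert:
  "conn (insert {u, v} C) x y \<longleftrightarrow>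
    conn C x y \<or> (conn C x u \<and> conn C v y) \<or> (conn C x v \<and> conn C u y)"
proof
  assume "conn (insert {u, v} C) x y"
  then show "conn C x y \<or> (conn C x u \<and> conn C v y) \<or> (conn C x v \<and> conn C u y)"
  proof (induction rule: conn_induct)
    case (step y z)
    show ?case
    proof (cases "{y, z} \<in> C")
      case True
      then show ?thesis using step.IH conn_edge conn_trans by metis
    next
      case False
      then have "y = u \<and> z = v \<or> y = v \<and> z = u" using step.hyps(2) by (auto simp: doubleton_eq_iff)
      then show ?thesis using step.IH conn_refl by metis
    qed
  qed simp
next
  have "conn (insert {u, v} C) u v" by (simp add: conn_edge)
  moreover have "conn (insert {u, v} C) a b" if "conn C a b" for a b
    using that by (rule conn_mono) auto
  ultimately show "conn C x y \<or> (conn C x u \<and> conn C v y) \<or> (conn C x v \<and> conn C u y) \<Longrightarrow>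
    conn (insert {u, v} C) x y"
    by (metis conn_trans conn_sym)
qed

text \<open>The edge is the last departure from \<open>v\<close> on a walk to \<open>x\<close>, so
  the rest of the walk avoids all edges at \<open>v\<close>. The induction follows the walk from
  \<open>x\<close> towards \<open>v\<close>.\<close>

lemma conn_first_edge:
  assumes "conn C v x" "v \<noteq> x"
  shows "\<exists>u. {v, u} \<in> C \<and> conn {e \<in> C. v \<notin> e} u x"
proof -
  let ?D = "{e \<in> C. v \<notin> e}"
  have "(y \<noteq> v \<and> conn ?D y x) \<or> (\<exists>u. {v, u} \<in> C \<and> conn ?D u x)" if "conn C x y" for y
    using that
  proof (induction rule: conn_induct)
    case refl
    then show ?case using assms(2) by simp
  next
    case (step y z)
    show ?case
    proof (cases "\<exists>u. {v, u} \<in> C \<and> conn ?D u x")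
      case False
      then have y: "y \<noteq> v" "conn ?D y x" using step.IH by auto
      show ?thesis
      proof (cases "z = v")
        case True
        then show ?thesis using step.hyps(2) y by (metis insert_commute)
      next
        case False
        then have "{z, y} \<in> ?D" using step.hyps(2) y by (auto simp: insert_commute)
        then have "conn ?D z x" using conn_trans[OF conn_edge y(2)] by blast
        then show ?thesis using False by blast
      qed
    qed blast
  qed
  from this[OF conn_sym[OF assms(1)]] show ?thesis by blast
qed

definition separated :: "'a set \<Rightarrow> 'a set set \<Rightarrow> bool" where
  "separated N C \<longleftrightarrow> (\<forall>x\<in>N. \<forall>y\<in>N. conn C x y \<longrightarrow> x = y)"

lemma separatedD: "separated N C \<Longrightarrow> x \<in> N \<Longrightarrow> y \<in> N \<Longrightarrow> conn C x y \<Longrightarrow> x = y"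
  by (simp add: separated_def)

lemma separated_mono: "separated N D \<Longrightarrow> C \<subseteq> D \<Longrightarrow> M \<subseteq> N \<Longrightarrow> separated M C"
  unfolding separated_def by (meson conn_mono subsetD)

text \<open>Moving \<open>v\<close> from \<open>P\<close> to \<open>N\<close> removes the factor of \<open>v\<close>: the lost terms \<open>C\<close> connect \<open>v\<close> to \<open>N\<close>,
  and are sorted by the edge at \<open>v\<close> that leads there. Deleting this edge \<open>e\<close> leaves exactly those sets
  that do not cancel under toggling \<open>e\<close> in the new sum.\<close>

lemma sum_separated:
  assumes "finite P" "finite I" "N \<inter> P = {}"
    and edge: "\<And>e. e \<in> I \<Longrightarrow> e \<subseteq> N \<union> P \<and> card e = 2"
    and forest: "\<And>C u v. C \<subseteq> I \<Longrightarrow> separated N C \<Longrightarrow> {u, v} \<in> C \<Longrightarrow> \<not> conn (C - {{u, v}}) u v"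
  shows "(\<Sum>C\<in>Pow I. (- 1) ^ card C * of_bool (separated N C)) =
    (\<Prod>v\<in>P. 1 - of_nat (degree I v) :: 'b::comm_ring_1)"
  using assms
proof (induction P arbitrary: N rule: finite_induct)
  case empty
  \<comment> \<open>With \<open>P\<close> empty every edge joins two vertices of \<open>N\<close>,
    so only the empty set is separated.\<close>
  have "(- 1 :: 'b) ^ card C * of_bool (separated N C) = 0" if C: "C \<in> Pow I - {{}}" for C
  proof -
    obtain e where e: "e \<in> C" "e \<in> I" using C by blast
    then obtain u w where uw: "e = {u, w}" "u \<noteq> w" "u \<in> N" "w \<in> N"
      using empty.prems(3)[OF e(2)] by (auto simp: card_2_iff)
    then have "\<not> separated N C" using conn_edge[of u w C] e by (auto simp: separated_def)
    then show ?thesis by simp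
  qed
  then have "(\<Sum>C\<in>Pow I - {{}}. (- 1 :: 'b) ^ card C * of_bool (separated N C)) = 0"
    by (rule sum.neutral[OF ballI])
  moreover have "finite (Pow I)" "separated N {}" using empty.prems(1) by (simp_all add: separated_def)
  ultimately show ?case by (subst sum.remove[of "Pow I" "{}"]) simp_all
next
  case (insert v P)
  let ?N' = "insert v N"
  let ?F = "\<lambda>N. (\<Sum>C\<in>Pow I. (- 1) ^ card C * of_bool (separated N C) :: 'b)"
  have v: "v \<notin> N" and finI: "finite I" using insert.prems by auto
  note forest = insert.prems(4)
  have IH: "?F ?N' = (\<Prod>v\<in>P. 1 - of_nat (degree I v))"
  proof (rule insert.IH)
    show "e \<subseteq> ?N' \<union> P \<and> card e = 2" if "e \<in> I" for e using insert.prems(3)[OF that] by auto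
    show "\<not> conn (C - {{u, w}}) u w" if "C \<subseteq> I" "separated ?N' C" "{u, w} \<in> C" for C u w
      using forest[OF that(1) separated_mono[OF that(2)] that(3)] by auto
  qed (use insert.prems insert.hyps in auto)
  \<comment> \<open>\<open>T e C\<close> says that \<open>C\<close> separates \<open>N\<close> and
    that \<open>e\<close> is an edge by which a path in \<open>C\<close> leaves \<open>v\<close>
    towards \<open>N\<close>.\<close>
  define T where "T e C \<longleftrightarrow> e \<in> C \<and> separated N C \<and> (\<exists>u. e = {v, u} \<and> (\<exists>x\<in>N. conn (C - {e}) u x))"
    for e C
  \<comment> \<open>The indicators for \<open>N\<close> and \<open>?N'\<close> differ exactly if
    \<open>C\<close> separates \<open>N\<close> but joins \<open>v\<close> to a vertex of
    \<open>N\<close>. There is then exactly one edge \<open>e\<close> with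
    \<open>T e C\<close>.\<close>
  have split: "(of_bool (separated N C) :: 'b) =
    of_bool (separated ?N' C) + (\<Sum>e | e \<in> I \<and> v \<in> e. of_bool (T e C))" if C: "C \<in> Pow I" for C
  proof (cases "separated N C \<and> (\<exists>x\<in>N. conn C v x)")
    case False
    have "\<not> T e C" for e
    proof
      assume T: "T e C"
      then obtain u x where u: "e = {v, u}" "x \<in> N" "conn (C - {e}) u x" by (auto simp: T_def)
      have "conn C v u" using T u(1) by (auto simp: T_def intro: conn_edge)
      moreover have "conn C u x" using u(3) by (rule conn_mono) auto
      ultimately have "conn C v x" by (rule conn_trans)
      then show False using False T u(2) by (auto simp: T_def)
    qed
    moreover have "separated N C \<longleftrightarrow> separated ?N' C"
    proof
      assume N: "separated N C"
      then have "\<not> conn C v x" "\<not> conn C x v" if "x \<in> N" for x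
        using False that conn_sym[of C x v] by auto
      then show "separated ?N' C" using N by (auto simp: separated_def)
    qed (auto intro: separated_mono)
    ultimately show ?thesis by simp
  next
    case True
    then obtain x where N: "separated N C" and x: "x \<in> N" "conn C v x" by blast
    have "v \<noteq> x" using x(1) v by auto
    then obtain u where u: "{v, u} \<in> C" "conn {e \<in> C. v \<notin> e} u x"
      using conn_first_edge[OF x(2)] by blast
    have "conn (C - {{v, u}}) u x" using u(2) by (rule conn_mono) auto
    then have Tu: "T {v, u} C" using u(1) N x(1) by (auto simp: T_def)
    \<comment> \<open>A second such edge \<open>e'\<close> would lie on a cycle: without it,
      \<open>v\<close> still reaches its other end through \<open>u\<close> and \<open>x\<close>,
      contrary to \<open>forest\<close>.\<close>
    have uniq: "e' = {v, u}" if T': "T e' C" for e'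
    proof (rule ccontr)
      assume ne: "e' \<noteq> {v, u}"
      obtain u' x' where u': "e' = {v, u'}" "x' \<in> N" "conn (C - {e'}) u' x'" "e' \<in> C"
        using T' by (auto simp: T_def)
      have "conn C u' x'" using u'(3) by (rule conn_mono) auto
      moreover have "conn C v u'" using u'(1,4) by (auto intro: conn_edge)
      ultimately have "conn C v x'" using conn_trans[of C v u' x'] by simp
      with conn_sym[OF x(2)] have "conn C x x'" by (rule conn_trans)
      then have [simp]: "x' = x" using separatedD[OF N] x(1) u'(2) by blast
      have ux: "conn (C - {e'}) u x" using u(2) by (rule conn_mono) (use u'(1) in auto)
      have "conn (C - {e'}) v u" using u(1) ne by (intro conn_edge) auto
      from conn_trans[OF this ux] have "conn (C - {e'}) v u'"
        by (rule conn_trans) (use u'(3) in \<open>simp add: conn_sym\<close>)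
      then show False using forest[of C v u'] C N u'(1,4) by auto
    qed
    have "(\<Sum>e | e \<in> I \<and> v \<in> e. of_bool (T e C) :: 'b) = (\<Sum>e\<in>{{v, u}}. of_bool (T e C))"
      using C u(1) finI uniq by (intro sum.mono_neutral_right) auto
    moreover have "\<not> separated ?N' C" using x \<open>v \<noteq> x\<close> by (auto simp: separated_def)
    ultimately show ?thesis using N Tu by simp
  qed
  have edge_sum: "(\<Sum>C\<in>Pow I. (- 1) ^ card C * of_bool (T e C)) = - ?F ?N'" if e: "e \<in> I" "v \<in> e" for e
  proof -
    have "card e = 2" using insert.prems(3)[OF e(1)] by simp
    then obtain u where u: "e = {v, u}" "u \<noteq> v" using e(2) by (auto simp: card_2_iff)
    define J where "J = I - {e}"
    have J: "I = insert e J" "finite J" "e \<notin> J" using e(1) finI by (auto simp: J_def)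
    \<comment> \<open>If \<open>C\<close> separates \<open>?N'\<close>, adding \<open>e\<close>
      destroys this exactly when \<open>u\<close> is joined to \<open>N\<close>, and that is exactly
      when \<open>T e (insert e C)\<close> holds.\<close>
    have summand: "of_bool (T e (insert e C)) = of_bool (separated ?N' C) - (of_bool (separated ?N' (insert e C)) :: 'b)"
      if C: "C \<in> Pow J" for C
    proof -
      have Ce: "insert e C - {{v, u}} = C" "insert e C \<subseteq> I" using C J u(1) by auto
      have conn_e: "conn (insert e C) x y \<longleftrightarrow>
        conn C x y \<or> (conn C x v \<and> conn C u y) \<or> (conn C x u \<and> conn C v y)" for x y
        unfolding u(1) by (rule conn_insert)
      \<comment> \<open>Otherwise adding \<open>e\<close> would close a cycle without changing the
        components, so the set would still separate \<open>N\<close>, contrary to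
        \<open>forest\<close>.\<close>
      have H1: "\<not> conn C u v" if s: "separated ?N' C"
      proof
        assume uv: "conn C u v"
        then have "conn (insert e C) x y \<longleftrightarrow> conn C x y" for x y
          unfolding conn_e using uv conn_sym[OF uv] by (meson conn_trans)
        then have "separated N (insert e C)" using s by (auto simp: separated_def)
        then have "\<not> conn (insert e C - {{v, u}}) v u" using Ce u(1) by (intro forest) auto
        then show False unfolding Ce using conn_sym[OF uv] by blast
      qed
      have H2: "\<not> conn C v u" if s: "separated N (insert e C)"
      proof -
        have "\<not> conn (insert e C - {{v, u}}) v u" using Ce u(1) s by (intro forest) auto
        then show ?thesis unfolding Ce .
      qed
      have "T e (insert e C) \<longleftrightarrow> separated N (insert e C) \<and> (\<exists>x\<in>N. conn C u x)"
        using Ce u by (auto simp: T_def doubleton_eq_iff)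
      also have "\<dots> \<longleftrightarrow> separated ?N' C \<and> (\<exists>x\<in>N. conn C u x)"
      proof (intro iffI; (elim conjE bexE)?)
        fix x assume s: "separated N (insert e C)" and x: "x \<in> N" "conn C u x"
        have no: "\<not> conn C v y" if y: "y \<in> N" for y
        proof
          assume vy: "conn C v y"
          then have "conn (insert e C) y x" using x(2) conn_sym[OF vy] unfolding conn_e by blast
          then have "y = x" using separatedD[OF s] y x(1) by blast
          then have "conn C v u" using conn_trans[OF vy, of u] conn_sym[OF x(2)] by simp
          then show False using H2[OF s] by blast
        qed
        then have "\<not> conn C y v" if "y \<in> N" for y using no[OF that] conn_sym[of C y v] by blast
        moreover have "separated N C" using s by (rule separated_mono) auto
        ultimately have "separated ?N' C" using no by (auto simp: separated_def)
        then show "separated ?N' C \<and> (\<exists>x\<in>N. conn C u x)" using x by blast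
      next
        fix x assume s: "separated ?N' C" and x: "x \<in> N" "conn C u x"
        have "y = z" if yz: "y \<in> N" "z \<in> N" "conn (insert e C) y z" for y z
        proof -
          have "\<not> conn C y v" "\<not> conn C v z" using separatedD[OF s] yz(1,2) v by blast+
          then have "conn C y z" using yz(3) by (simp add: conn_e)
          then show ?thesis using separatedD[OF s] yz(1,2) by blast
        qed
        then show "separated N (insert e C) \<and> (\<exists>x\<in>N. conn C u x)" using x by (auto simp: separated_def)
      qed
      finally have T: "T e (insert e C) \<longleftrightarrow> separated ?N' C \<and> (\<exists>x\<in>N. conn C u x)" .
      have "separated ?N' (insert e C) \<longleftrightarrow> separated ?N' C \<and> \<not> (\<exists>x\<in>N. conn C u x)"
      proof (intro iffI conjI notI; (elim conjE bexE)?)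
        fix x assume s: "separated ?N' (insert e C)" and x: "x \<in> N" "conn C u x"
        have "conn (insert e C) v x" using x(2) by (simp add: conn_e)
        then show False using separatedD[OF s, of v x] x(1) v by blast
      next
        assume s: "separated ?N' C" and no: "\<not> (\<exists>x\<in>N. conn C u x)"
        have nu: "\<not> conn C u y" "\<not> conn C y u" if "y \<in> ?N'" for y
          using no H1[OF s] that conn_sym[of C y u] by auto
        show "separated ?N' (insert e C)"
          unfolding separated_def conn_e using nu separatedD[OF s] by blast
      qed (auto intro: separated_mono)
      with T show ?thesis by auto
    qed
    have cardC: "card (insert e C) = Suc (card C)" if "C \<in> Pow J" for C
      using that J by (subst card_insert_disjoint) (auto intro: finite_subset)
    have notT: "\<not> T e C" if "C \<in> Pow J" for C using that J by (auto simp: T_def)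
    \<comment> \<open>Only the sets containing \<open>e\<close> contribute, and removing
      \<open>e\<close> from them flips the sign.\<close>
    have "(\<Sum>C\<in>Pow I. (- 1 :: 'b) ^ card C * of_bool (T e C)) =
      (\<Sum>C\<in>Pow J. - ((- 1) ^ card C * (of_bool (separated ?N' C) - of_bool (separated ?N' (insert e C)))))"
      unfolding J(1) sum_Pow_insert[OF J(2,3)]
      by (intro sum.cong refl) (simp add: cardC notT summand)
    also have "\<dots> = - ?F ?N'"
      unfolding J(1) sum_Pow_insert[OF J(2,3)] sum_negf[symmetric]
      by (intro sum.cong refl) (simp add: cardC algebra_simps)
    finally show ?thesis .
  qed
  \<comment> \<open>Each of the \<open>degree I v\<close> edges at \<open>v\<close> contributes
    \<open>- ?F ?N'\<close>, which gives the factor of \<open>v\<close>.\<close>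
  have "?F N = (\<Sum>C\<in>Pow I. (- 1) ^ card C * of_bool (separated ?N' C) +
      (\<Sum>e | e \<in> I \<and> v \<in> e. (- 1) ^ card C * of_bool (T e C)))"
    by (intro sum.cong refl) (simp only: split distrib_left sum_distrib_left)
  also have "\<dots> = ?F ?N' + (\<Sum>e | e \<in> I \<and> v \<in> e. \<Sum>C\<in>Pow I. (- 1) ^ card C * of_bool (T e C))"
    by (simp only: sum.distrib sum.swap[of _ "Pow I"])
  also have "\<dots> = ?F ?N' + (\<Sum>e | e \<in> I \<and> v \<in> e. - ?F ?N')"
    by (intro arg_cong2[where f = "(+)"] refl sum.cong) (auto intro: edge_sum)
  also have "\<dots> = (1 - of_nat (degree I v)) * ?F ?N'"
    by (simp add: degree_def algebra_simps del: of_bool_eq)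
  also have "\<dots> = (\<Prod>v\<in>insert v P. 1 - of_nat (degree I v))"
    using insert.hyps by (simp add: IH)
  finally show ?case .
qed

section \<open>The leading term\<close>

text \<open>In decreasing order the lists agree on all entries above \<open>K\<close>. At the first
  difference \<open>ys\<close> still shows a \<open>K\<close>, while \<open>xs\<close> has a smaller
  entry or has ended.\<close>

lemma lex_less_of_count:
  fixes xs ys :: "nat list"
  assumes "sorted_wrt (\<ge>) xs" "sorted_wrt (\<ge>) ys"
    and "\<And>j. j > K \<Longrightarrow> count (mset xs) j = count (mset ys) j"
    and "count (mset xs) K < count (mset ys) K"
  shows "xs < ys"
  using assms
proof (induction xs arbitrary: ys)
  case Nil
  then show ?case by (cases ys) auto
next
  case (Cons x xs)
  obtain y ys' where ys: "ys = y # ys'" using Cons.prems(4) by (cases ys) auto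
  have "K \<in># mset ys" using Cons.prems(4) by (metis count_inI not_less0)
  then have Ky: "K \<le> y" using Cons.prems(2) by (auto simp: ys)
  \<comment> \<open>Otherwise \<open>x\<close> exceeds \<open>K\<close> and therefore also occurs in
    \<open>ys\<close>, whose largest entry is \<open>y\<close>.\<close>
  have "\<not> y < x"
  proof
    assume yx: "y < x"
    then have "count (mset (x # xs)) x = count (mset ys) x" using Ky by (intro Cons.prems(3)) simp
    then have "x \<in># mset ys" by (intro count_inI) simp
    then show False using yx Cons.prems(2) by (auto simp: ys)
  qed
  moreover have "xs < ys'" if "x = y"
  proof (rule Cons.IH)
    show "count (mset xs) j = count (mset ys') j" if "j > K" for j
      using Cons.prems(3)[OF that] \<open>x = y\<close> by (simp add: ys split: if_splits)
    show "count (mset xs) K < count (mset ys') K"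
      using Cons.prems(4) \<open>x = y\<close> by (simp add: ys split: if_splits)
  qed (use Cons.prems(1,2) ys in auto)
  ultimately show ?case by (auto simp: ys)
qed

lemma count_image_mset_mset_set:
  assumes "finite X"
  shows "count (image_mset f (mset_set X)) j = card {x \<in> X. f x = j}"
  using assms
proof induction
  case (insert x X)
  have "{y \<in> insert x X. f y = j} = (if f x = j then insert x {y \<in> X. f y = j} else {y \<in> X. f y = j})"
    by auto
  then show ?case using insert by simp
qed simp

lemma sorted_partition_of: "sorted_wrt (\<ge>) (partition_of T)"
  by (simp add: partition_of_def sorted_wrt_rev)

text \<open>Different \<open>j\<close> may have the same partition, so the terms are first collected
  by partition. By uniqueness the totals are the star coefficients; they vanish below
  \<open>\<mu>\<close>, and at \<open>\<mu>\<close> the total is the nonzero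
  \<open>x\<close>.\<close>

lemma leading_coeff_eqI:
  fixes f :: series
  assumes fin: "finite J"
    and t: "\<And>j. j \<in> J \<Longrightarrow> t j \<in> partitions n"
    and f: "\<And>M. f M = (\<Sum>j\<in>J. a j * star_product (t j) M)"
    and le: "\<And>j. j \<in> J \<Longrightarrow> \<mu> \<le> t j"
    and x: "(\<Sum>j\<in>J. a j * of_bool (t j = \<mu>)) = x" "x \<noteq> 0"
  shows "leading_coeff n f = x"
proof -
  define c where "c ps = (\<Sum>j\<in>J. a j * of_bool (t j = ps))" for ps
  have c0: "\<exists>j\<in>J. t j = ps" if "c ps \<noteq> 0" for ps
  proof (rule ccontr)
    assume "\<not> (\<exists>j\<in>J. t j = ps)"
    then have "c ps = 0" unfolding c_def by (intro sum.neutral) auto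
    then show False using that by simp
  qed
  have "f M = (\<Sum>ps\<in>partitions n. c ps * star_product ps M)" for M
  proof -
    have "(\<Sum>ps\<in>partitions n. c ps * star_product ps M) =
      (\<Sum>ps\<in>partitions n. \<Sum>j\<in>J. a j * of_bool (t j = ps) * star_product ps M)"
      by (simp only: c_def sum_distrib_right)
    also have "\<dots> = (\<Sum>j\<in>J. \<Sum>ps\<in>partitions n. a j * of_bool (t j = ps) * star_product ps M)"
      by (rule sum.swap)
    also have "\<dots> = (\<Sum>j\<in>J. a j * star_product (t j) M)"
    proof (rule sum.cong[OF refl])
      fix j assume j: "j \<in> J"
      have "(\<Sum>ps\<in>partitions n. a j * of_bool (t j = ps) * star_product ps M) =
        (\<Sum>ps\<in>{t j}. a j * of_bool (t j = ps) * star_product ps M)"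
        using t[OF j] finite_partitions[of n] by (intro sum.mono_neutral_right) auto
      then show "(\<Sum>ps\<in>partitions n. a j * of_bool (t j = ps) * star_product ps M) =
        a j * star_product (t j) M" by simp
    qed
    finally show ?thesis using f by simp
  qed
  moreover have "c ps = 0" if "ps \<notin> partitions n" for ps using c0[of ps] t that by auto
  ultimately have "star_expansion n f c" unfolding star_expansion_def by blast
  then have coeffs: "star_coeffs n f = c" by (rule star_coeffs_eq)
  have cl: "c \<mu> = x" using x(1) by (simp add: c_def)
  have "Min {ps \<in> partitions n. c ps \<noteq> 0} = \<mu>"
  proof (rule Min_eqI)
    show "finite {ps \<in> partitions n. c ps \<noteq> 0}" using finite_partitions[of n] by simp
    show "\<mu> \<le> ps" if "ps \<in> {ps \<in> partitions n. c ps \<noteq> 0}" for ps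
      using c0[of ps] le that by auto
    show "\<mu> \<in> {ps \<in> partitions n. c ps \<noteq> 0}" using c0[of \<mu>] cl x(2) t by auto
  qed
  then show ?thesis by (simp add: leading_coeff_def lead_partition_def coeffs cl)
qed

text \<open>Here \<open>h\<close> sends every internal vertex to the representative of its class, \<open>p\<close> sends a leaf to
  its neighbour and \<open>B\<close> is a set of internal vertices that are not representatives. The largest
  part at which the two partitions differ is carried by a representative.\<close>

lemma star_type_clusters:
  fixes W L :: "'a set"
  assumes fin: "finite W" "finite L" and disj: "W \<inter> L = {}"
    and p: "p ` L \<subseteq> W"
    and h: "\<And>w. w \<in> W \<Longrightarrow> h w \<in> W" "\<And>w. w \<in> W \<Longrightarrow> h (h w) = h w"
    and hp: "\<And>w. w \<in> p ` L \<Longrightarrow> h w \<in> p ` L"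
    and B: "B \<subseteq> {w \<in> W. h w \<noteq> w}"
  defines "g \<equiv> \<lambda>v. if v \<in> W then h v else h (p v)"
    and "A \<equiv> star_type (W \<union> L) L p"
  shows "B = {} \<Longrightarrow> \<forall>w\<in>p ` L. h w = w \<Longrightarrow> star_type (W \<union> L) (B \<union> L) g = A"
    and "\<not> (B = {} \<and> (\<forall>w\<in>p ` L. h w = w)) \<Longrightarrow>
      partition_of A < partition_of (star_type (W \<union> L) (B \<union> L) g)"
proof -
  \<comment> \<open>\<open>a\<close> gives the star sizes counted by \<open>A\<close>,
    \<open>t\<close> those of the clustered forest.\<close>
  define a where "a w = Suc (card {l \<in> L. p l = w})" for w
  define t where "t w = Suc (card {v \<in> B \<union> L. g v = w})" for w
  have BW: "B \<subseteq> W" "finite B" using B fin by (auto intro: finite_subset)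
  have W: "(W \<union> L) - L = W" "(W \<union> L) - (B \<union> L) = W - B" using disj by auto
  have A: "A = image_mset a (mset_set W)"
    unfolding A_def star_type_def W a_def ..
  have T: "star_type (W \<union> L) (B \<union> L) g = image_mset t (mset_set (W - B))"
    unfolding star_type_def W t_def ..
  have gB: "g v = h v" if "v \<in> B" for v using that BW by (auto simp: g_def)
  have gL: "g l = h (p l)" if "l \<in> L" for l using that disj by (auto simp: g_def)
  have hg: "h (g v) = g v" if "v \<in> B \<union> L" for v
    using that h(2) p BW gB gL by (metis Un_iff imageI subsetD)
  have t1: "t w = 1" if "h w \<noteq> w" for w
    using hg that by (auto simp: t_def card_eq_0_iff)
  have finT: "finite {v \<in> B \<union> L. g v = r}" for r using BW fin by auto
  have sub: "{l \<in> L. p l = w} \<subseteq> {v \<in> B \<union> L. g v = r}" if "h w = r" for w r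
    using that gL by auto
  have le: "a r \<le> t r" if "h r = r" for r
    unfolding a_def t_def Suc_le_mono using card_mono[OF finT sub[OF that]] .
  have a1: "a w = 1" if "w \<notin> p ` L" for w
    using that by (auto simp: a_def card_eq_0_iff)
  have aL: "a w > 1" if "w \<in> p ` L" for w
  proof -
    have "finite {l \<in> L. p l = w}" "{l \<in> L. p l = w} \<noteq> {}" using fin that by auto
    then show ?thesis by (simp add: a_def card_gt_0_iff)
  qed
  \<comment> \<open>If the star of a representative has not grown, its class has no vertex in
    \<open>B\<close> and bears leaves at most at the representative, so all parts of this class are
    unchanged.\<close>
  have good: "w \<notin> B \<and> t w = a w \<and> (w \<in> p ` L \<longrightarrow> h w = w)"
    if r: "t r = a r" and w: "w \<in> W" "h w = r" for w r
  proof -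
    have hr: "h r = r" using w h(2) by metis
    have "card {l \<in> L. p l = r} = card {v \<in> B \<union> L. g v = r}" using r by (simp add: a_def t_def)
    then have eq: "{l \<in> L. p l = r} = {v \<in> B \<union> L. g v = r}"
      using finT sub[OF hr] by (intro card_subset_eq)
    have "w \<notin> B"
    proof
      assume "w \<in> B"
      then have "w \<in> {l \<in> L. p l = r}" unfolding eq using w(2) gB by simp
      then show False using disj w(1) by auto
    qed
    moreover have wr: "w = r" if "w \<in> p ` L"
    proof -
      obtain l where l: "l \<in> L" "w = p l" using \<open>w \<in> p ` L\<close> by auto
      then have "l \<in> {l \<in> L. p l = r}" unfolding eq using gL w(2) by simp
      then show ?thesis using l by simp
    qed
    moreover have "t w = a w"
    proof (cases "w = r")
      case False
      then show ?thesis using a1 t1 wr w(2) by metis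
    qed (use r in simp)
    ultimately show ?thesis using hr by auto
  qed
  \<comment> \<open>A star that has grown exceeds every old star of its class. Here
    \<open>hp\<close> enters: if another \<open>w\<close> of the class bears leaves, so does
    \<open>r\<close>, and gaining the leaves of \<open>r\<close> makes the new star larger than the
    old one at \<open>w\<close>.\<close>
  have bad: "a w < t r" if r: "t r \<noteq> a r" and w: "w \<in> W" "h w = r" for w r
  proof -
    have hr: "h r = r" using w h(2) by metis
    then have less: "a r < t r" using r le by (simp add: le_neq_implies_less)
    show ?thesis
    proof (cases "w \<in> p ` L \<and> w \<noteq> r")
      case True
      have "card ({l \<in> L. p l = w} \<union> {l \<in> L. p l = r}) \<le> card {v \<in> B \<union> L. g v = r}"
        using sub[OF w(2)] sub[OF hr] finT by (intro card_mono) auto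
      moreover have "card ({l \<in> L. p l = w} \<union> {l \<in> L. p l = r}) =
          card {l \<in> L. p l = w} + card {l \<in> L. p l = r}"
        using True fin by (intro card_Un_disjoint) auto
      moreover have "a r > 1" using aL hp[of w] True w(2) by simp
      ultimately show ?thesis by (simp add: a_def t_def)
    next
      case False
      then show ?thesis using less a1[of w] by (cases "w = r") (auto simp: a_def)
    qed
  qed
  {
    assume "B = {}" and N: "\<forall>w\<in>p ` L. h w = w"
    then have gl: "g l = p l" if "l \<in> L" for l using that gL by simp
    have "t w = a w" for w
      unfolding t_def a_def using \<open>B = {}\<close> gl by (intro arg_cong[where f = "\<lambda>X. Suc (card X)"]) auto
    then have "t = a" by (rule ext)
    then show "star_type (W \<union> L) (B \<union> L) g = A"
      using \<open>B = {}\<close> unfolding T A by simp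
  }
  assume not_good: "\<not> (B = {} \<and> (\<forall>w\<in>p ` L. h w = w))"
  define R where "R = {r \<in> W. h r = r \<and> t r \<noteq> a r}"
  have hR: "h w \<in> R" if "w \<in> W" "t (h w) \<noteq> a (h w)" for w
    using that h by (simp add: R_def)
  have finR: "finite R" using fin by (simp add: R_def)
  have "R \<noteq> {}"
  proof
    assume "R = {}"
    then have "w \<notin> B \<and> (w \<in> p ` L \<longrightarrow> h w = w)" if "w \<in> W" for w
      using good[OF _ that refl] hR[OF that] by auto
    then show False using not_good p BW by blast
  qed
  \<comment> \<open>\<open>K\<close> is the largest new star at a changed representative: above it
    all multiplicities agree, and at \<open>K\<close> the vertex \<open>k\<close> provides an
    additional part.\<close>
  define K where "K = Max (t ` R)"
  have tK: "t r \<le> K" if "r \<in> R" for r using that finR by (simp add: K_def)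
  have "K \<in> t ` R" unfolding K_def using finR \<open>R \<noteq> {}\<close> by (intro Max_in) auto
  then obtain k where k: "k \<in> R" "t k = K" by auto
  have kB: "k \<in> W - B" "a k < K" "h k = k"
    using k B bad[of k k] by (auto simp: R_def)
  have K1: "1 \<le> K" using k by (auto simp: t_def)
  have AT: "{w \<in> W. a w = j} \<subseteq> {w \<in> W - B. t w = j}" if j: "K \<le> j" for j
  proof
    fix w assume "w \<in> {w \<in> W. a w = j}"
    then have w: "w \<in> W" "j = a w" by auto
    have "t (h w) = a (h w)"
    proof (rule ccontr)
      assume ne: "t (h w) \<noteq> a (h w)"
      then have "a w < t (h w)" using bad w by blast
      also have "\<dots> \<le> K" using tK hR[OF w(1) ne] by blast
      finally show False using j w by simp
    qed
    from good[OF this w(1) refl] show "w \<in> {w \<in> W - B. t w = j}" using w by simp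
  qed
  \<comment> \<open>A vertex that is no representative has a star of size 1 in the clustered forest,
    hence at most \<open>K\<close>; this is where \<open>K1\<close> is used.\<close>
  have TA: "{w \<in> W - B. t w = j} \<subseteq> {w \<in> W. a w = j}" if j: "K < j" for j
  proof
    fix w assume "w \<in> {w \<in> W - B. t w = j}"
    then have w: "w \<in> W" "w \<notin> B" "j = t w" by auto
    have "t (h w) = a (h w)"
    proof (rule ccontr)
      assume ne: "t (h w) \<noteq> a (h w)"
      show False
      proof (cases "h w = w")
        case True
        then show False using tK[OF hR[OF w(1) ne]] j w by simp
      next
        case False
        then show False using t1 K1 j w by simp
      qed
    qed
    from good[OF this w(1) refl] show "w \<in> {w \<in> W. a w = j}" using w by simp
  qed
  show "partition_of A < partition_of (star_type (W \<union> L) (B \<union> L) g)"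
  proof (rule lex_less_of_count[where K = K])
    show "count (mset (partition_of A)) j = count (mset (partition_of (star_type (W \<union> L) (B \<union> L) g))) j"
      if "j > K" for j
      unfolding mset_partition_of A T count_image_mset_mset_set[OF fin(1)]
        count_image_mset_mset_set[OF finite_Diff[OF fin(1)]]
      using AT[of j] TA[of j] that by (intro arg_cong[where f = card] subset_antisym) auto
    have "k \<in> {w \<in> W - B. t w = K}" "k \<notin> {w \<in> W. a w = K}" using k kB by auto
    then have "{w \<in> W. a w = K} \<subset> {w \<in> W - B. t w = K}" using AT[of K] by blast
    then show "count (mset (partition_of A)) K < count (mset (partition_of (star_type (W \<union> L) (B \<union> L) g))) K"
      unfolding mset_partition_of A T count_image_mset_mset_set[OF fin(1)]
        count_image_mset_mset_set[OF finite_Diff[OF fin(1)]]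
      using fin by (intro psubset_card_mono) auto
  qed (rule sorted_partition_of)+
qed

text \<open>Constancy along edges propagates through components. Stated with representatives it is
  one equation per vertex, even if \<open>S\<close> contains cycles, and these equations have the
  form of stars.\<close>

lemma mono_on_edges_iff:
  assumes S: "\<And>e. e \<in> S \<Longrightarrow> e \<subseteq> W \<and> card e = 2"
    and h: "\<And>w. conn S w (h w)" "\<And>w w'. conn S w w' \<Longrightarrow> h w = h w'"
  shows "(\<forall>e\<in>S. \<forall>x\<in>e. \<forall>y\<in>e. \<kappa> x = \<kappa> y) \<longleftrightarrow> (\<forall>w\<in>W. \<kappa> w = \<kappa> (h w))"
proof
  assume mono: "\<forall>e\<in>S. \<forall>x\<in>e. \<forall>y\<in>e. \<kappa> x = \<kappa> y"
  have "\<kappa> x = \<kappa> y" if "conn S x y" for x y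
    using that
  proof (induction rule: conn_induct)
    case (step y z)
    have "\<kappa> y = \<kappa> z" using mono[rule_format, OF step.hyps(2), of y z] by simp
    then show ?case using step.IH by simp
  qed simp
  from this[OF h(1)] show "\<forall>w\<in>W. \<kappa> w = \<kappa> (h w)" by simp
next
  assume r: "\<forall>w\<in>W. \<kappa> w = \<kappa> (h w)"
  show "\<forall>e\<in>S. \<forall>x\<in>e. \<forall>y\<in>e. \<kappa> x = \<kappa> y"
  proof (intro ballI)
    fix e x y assume e: "e \<in> S" "x \<in> e" "y \<in> e"
    have "conn S x y"
    proof (cases "x = y")
      case False
      then have "e = {x, y}" using S[OF e(1)] e(2,3) by (auto simp: card_2_iff)
      then show ?thesis using e(1) by (auto intro: conn_edge)
    qed simp
    then have "h x = h y" by (rule h(2))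
    moreover have "x \<in> W" "y \<in> W" using S[OF e(1)] e by auto
    then have "\<kappa> x = \<kappa> (h x)" "\<kappa> y = \<kappa> (h y)" using r by auto
    ultimately show "\<kappa> x = \<kappa> y" by simp
  qed
qed

text \<open>Inclusion-exclusion over the edges in \<open>I\<close> collapses every component of \<open>S\<close> to its representative,
  and a second inclusion-exclusion rewrites monochromatic components by stars.\<close>

lemma chromatic_symfun_leaves:
  fixes W L :: "'a set" and I :: "'a set set"
  assumes fin: "finite W" "finite L" "finite I" and disj: "W \<inter> L = {}"
    and p: "p ` L \<subseteq> W"
    and I: "\<And>e. e \<in> I \<Longrightarrow> e \<subseteq> W \<and> card e = 2"
    and h: "\<And>S w. conn S w (h S w)" "\<And>S w w'. conn S w w' \<Longrightarrow> h S w = h S w'"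
  shows "chromatic_symfun (W \<union> L) (I \<union> {{l, p l} | l. l \<in> L}) M =
    (\<Sum>S\<in>Pow I. \<Sum>B\<in>Pow {w \<in> W. h S w \<noteq> w}. (- 1) ^ card S * (- 1) ^ card B *
      chromatic_symfun (W \<union> L) {{v, if v \<in> W then h S v else h S (p v)} | v. v \<in> B \<union> L} M)"
proof -
  define mono where "mono \<kappa> e \<longleftrightarrow> (\<forall>x\<in>e. \<forall>y\<in>e. \<kappa> x = \<kappa> y)" for \<kappa> :: "'a \<Rightarrow> nat" and e
  define g where "g S v = (if v \<in> W then h S v else h S (p v))" for S v
  have finV: "finite (W \<union> L)" and finR: "finite {w \<in> W. h S w \<noteq> w}" for S
    using fin by simp_all
  \<comment> \<open>The identity already holds for each single coloring; the sum over colorings is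
    taken only afterwards.\<close>
  have point: "(of_bool (\<forall>u v. {u, v} \<in> I \<union> {{l, p l} | l. l \<in> L} \<longrightarrow> \<kappa> u \<noteq> \<kappa> v) :: rat) =
    (\<Sum>S\<in>Pow I. \<Sum>B\<in>Pow {w \<in> W. h S w \<noteq> w}. (- 1) ^ card S * (- 1) ^ card B *
      of_bool (\<forall>v\<in>B \<union> L. \<kappa> v \<noteq> \<kappa> (g S v)))" for \<kappa> :: "'a \<Rightarrow> nat"
  proof -
    have "(\<forall>u v. {u, v} \<in> I \<longrightarrow> \<kappa> u \<noteq> \<kappa> v) \<longleftrightarrow> (\<forall>e\<in>I. \<not> mono \<kappa> e)"
    proof
      assume ne: "\<forall>u v. {u, v} \<in> I \<longrightarrow> \<kappa> u \<noteq> \<kappa> v"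
      show "\<forall>e\<in>I. \<not> mono \<kappa> e"
      proof
        fix e assume e: "e \<in> I"
        then obtain u v where "e = {u, v}" using I by (meson card_2_iff)
        then show "\<not> mono \<kappa> e" using ne e by (auto simp: mono_def)
      qed
    next
      assume ne: "\<forall>e\<in>I. \<not> mono \<kappa> e"
      show "\<forall>u v. {u, v} \<in> I \<longrightarrow> \<kappa> u \<noteq> \<kappa> v"
      proof (intro allI impI notI)
        fix u v assume "{u, v} \<in> I" "\<kappa> u = \<kappa> v"
        then have "mono \<kappa> {u, v}" by (simp add: mono_def)
        then show False using ne \<open>{u, v} \<in> I\<close> by blast
      qed
    qed
    moreover have "(\<forall>u v. {u, v} \<in> {{l, p l} | l. l \<in> L} \<longrightarrow> \<kappa> u \<noteq> \<kappa> v) \<longleftrightarrow> (\<forall>l\<in>L. \<kappa> l \<noteq> \<kappa> (p l))"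
      by (auto simp: doubleton_eq_iff)
    ultimately have "(of_bool (\<forall>u v. {u, v} \<in> I \<union> {{l, p l} | l. l \<in> L} \<longrightarrow> \<kappa> u \<noteq> \<kappa> v) :: rat) =
      of_bool (\<forall>e\<in>I. \<not> mono \<kappa> e) * of_bool (\<forall>l\<in>L. \<kappa> l \<noteq> \<kappa> (p l))"
      unfolding of_bool_conj[symmetric] by (intro arg_cong[where f = of_bool]) blast
    also have "\<dots> = (\<Sum>S\<in>Pow I. (- 1) ^ card S * (of_bool (\<forall>e\<in>S. mono \<kappa> e) * of_bool (\<forall>l\<in>L. \<kappa> l \<noteq> \<kappa> (p l))))"
      unfolding of_bool_none_eq_sum[OF fin(3)] sum_distrib_right by (simp only: mult.assoc)
    also have "\<dots> = (\<Sum>S\<in>Pow I. (- 1) ^ card S *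
      (\<Sum>B\<in>Pow {w \<in> W. h S w \<noteq> w}. (- 1) ^ card B * of_bool (\<forall>v\<in>B \<union> L. \<kappa> v \<noteq> \<kappa> (g S v))))"
    proof (intro sum.cong refl arg_cong2[where f = "(*)"])
      fix S assume "S \<in> Pow I"
      then have "(\<forall>e\<in>S. mono \<kappa> e) \<longleftrightarrow> (\<forall>w\<in>W. \<kappa> w = \<kappa> (h S w))"
        unfolding mono_def by (intro mono_on_edges_iff h) (use I in auto)
      moreover have "\<dots> \<longleftrightarrow> (\<forall>w\<in>{w \<in> W. h S w \<noteq> w}. \<not> \<kappa> w \<noteq> \<kappa> (h S w))" by force
      \<comment> \<open>On colorings constant on the components of \<open>S\<close>, a leaf may be
        compared with the representative of its neighbour instead of the neighbour itself.\<close>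
      moreover have "(\<forall>w\<in>W. \<kappa> w = \<kappa> (h S w)) \<Longrightarrow>
          (\<forall>l\<in>L. \<kappa> l \<noteq> \<kappa> (p l)) \<longleftrightarrow> (\<forall>l\<in>L. \<kappa> l \<noteq> \<kappa> (g S l))"
      proof -
        assume r: "\<forall>w\<in>W. \<kappa> w = \<kappa> (h S w)"
        have "\<kappa> (p l) = \<kappa> (g S l)" if "l \<in> L" for l
        proof -
          have "p l \<in> W" "l \<notin> W" using that p disj by auto
          then show ?thesis using r by (simp add: g_def)
        qed
        then show ?thesis by simp
      qed
      ultimately have "of_bool (\<forall>e\<in>S. mono \<kappa> e) * of_bool (\<forall>l\<in>L. \<kappa> l \<noteq> \<kappa> (p l)) =
        of_bool (\<forall>w\<in>{w \<in> W. h S w \<noteq> w}. \<not> \<kappa> w \<noteq> \<kappa> (h S w)) * (of_bool (\<forall>l\<in>L. \<kappa> l \<noteq> \<kappa> (g S l)) :: rat)"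
        unfolding of_bool_conj[symmetric] by (intro arg_cong[where f = of_bool]) blast
      \<comment> \<open>Expanding the equations with the representatives into inequalities turns the
        vertices of \<open>B\<close> into leaves, just like those of \<open>L\<close>.\<close>
      also have "\<dots> = (\<Sum>B\<in>Pow {w \<in> W. h S w \<noteq> w}. (- 1) ^ card B *
          (of_bool (\<forall>v\<in>B. \<kappa> v \<noteq> \<kappa> (h S v)) * of_bool (\<forall>l\<in>L. \<kappa> l \<noteq> \<kappa> (g S l))))"
        unfolding of_bool_none_eq_sum[OF finR] sum_distrib_right by (simp only: mult.assoc not_not)
      also have "\<dots> = (\<Sum>B\<in>Pow {w \<in> W. h S w \<noteq> w}. (- 1) ^ card B *
          of_bool (\<forall>v\<in>B \<union> L. \<kappa> v \<noteq> \<kappa> (g S v)))"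
      proof (intro sum.cong refl arg_cong2[where f = "(*)"])
        fix B assume "B \<in> Pow {w \<in> W. h S w \<noteq> w}"
        then have "g S v = h S v" if "v \<in> B" for v using that by (auto simp: g_def)
        then have "(\<forall>v\<in>B. \<kappa> v \<noteq> \<kappa> (h S v)) \<longleftrightarrow> (\<forall>v\<in>B. \<kappa> v \<noteq> \<kappa> (g S v))" by simp
        then show "of_bool (\<forall>v\<in>B. \<kappa> v \<noteq> \<kappa> (h S v)) * of_bool (\<forall>l\<in>L. \<kappa> l \<noteq> \<kappa> (g S l)) =
          (of_bool (\<forall>v\<in>B \<union> L. \<kappa> v \<noteq> \<kappa> (g S v)) :: rat)"
          unfolding of_bool_conj[symmetric] by (intro arg_cong[where f = of_bool]) blast
      qed
      finally show "of_bool (\<forall>e\<in>S. mono \<kappa> e) * of_bool (\<forall>l\<in>L. \<kappa> l \<noteq> \<kappa> (p l)) =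
        (\<Sum>B\<in>Pow {w \<in> W. h S w \<noteq> w}. (- 1) ^ card B *
          (of_bool (\<forall>v\<in>B \<union> L. \<kappa> v \<noteq> \<kappa> (g S v)) :: rat))" .
    qed
    finally show ?thesis by (simp only: sum_distrib_left mult.assoc)
  qed
  have "chromatic_symfun (W \<union> L) (I \<union> {{l, p l} | l. l \<in> L}) M =
    (\<Sum>\<kappa>\<in>colorings_with (W \<union> L) M. \<Sum>S\<in>Pow I. \<Sum>B\<in>Pow {w \<in> W. h S w \<noteq> w}.
      (- 1) ^ card S * (- 1) ^ card B * of_bool (\<forall>v\<in>B \<union> L. \<kappa> v \<noteq> \<kappa> (g S v)))"
    unfolding chromatic_symfun_sum[OF finV] point ..
  also have "\<dots> = (\<Sum>S\<in>Pow I. \<Sum>\<kappa>\<in>colorings_with (W \<union> L) M. \<Sum>B\<in>Pow {w \<in> W. h S w \<noteq> w}.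
      (- 1) ^ card S * (- 1) ^ card B * of_bool (\<forall>v\<in>B \<union> L. \<kappa> v \<noteq> \<kappa> (g S v)))"
    by (rule sum.swap)
  also have "\<dots> = (\<Sum>S\<in>Pow I. \<Sum>B\<in>Pow {w \<in> W. h S w \<noteq> w}. \<Sum>\<kappa>\<in>colorings_with (W \<union> L) M.
      (- 1) ^ card S * (- 1) ^ card B * of_bool (\<forall>v\<in>B \<union> L. \<kappa> v \<noteq> \<kappa> (g S v)))"
    by (intro sum.cong refl sum.swap)
  also have "\<dots> = (\<Sum>S\<in>Pow I. \<Sum>B\<in>Pow {w \<in> W. h S w \<noteq> w}. (- 1) ^ card S * (- 1) ^ card B *
      chromatic_symfun (W \<union> L) {{v, g S v} | v. v \<in> B \<union> L} M)"
    by (simp only: star_forest_sum[OF finV] sum_distrib_left)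
  finally show ?thesis unfolding g_def .
qed

text \<open>The smallest type \<open>\<mu>\<close> is that of the star forest joining each leaf to
  its neighbour. It occurs exactly for empty \<open>B\<close> and separating \<open>S\<close>, and
  the signs of these terms add up to \<open>x\<close>.\<close>

lemma leading_coeff_leaves:
  fixes W L :: "'a set" and I :: "'a set set"
  assumes fin: "finite W" "finite L" "finite I" and disj: "W \<inter> L = {}"
    and p: "p ` L \<subseteq> W"
    and I: "\<And>e. e \<in> I \<Longrightarrow> e \<subseteq> W \<and> card e = 2"
    and nz: "(\<Sum>S\<in>Pow I. (- 1) ^ card S * of_bool (separated (p ` L) S)) = x" "x \<noteq> 0"
  shows "leading_coeff (card (W \<union> L)) (chromatic_symfun (W \<union> L) (I \<union> {{l, p l} | l. l \<in> L})) = x"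
proof -
  let ?N = "p ` L"
  \<comment> \<open>The choice depends on \<open>w\<close> only through its component, so it is
    constant on components; it prefers vertices that bear leaves, as the comparison of types
    requires.\<close>
  define h where "h S w = (SOME r. conn S w r \<and> ((\<exists>x\<in>?N. conn S w x) \<longrightarrow> r \<in> ?N))" for S w
  have h_ex: "\<exists>r. conn S w r \<and> ((\<exists>x\<in>?N. conn S w x) \<longrightarrow> r \<in> ?N)" for S w
    by (cases "\<exists>x\<in>?N. conn S w x") (auto intro: conn_refl)
  have h: "conn S w (h S w)" "(\<exists>x\<in>?N. conn S w x) \<longrightarrow> h S w \<in> ?N" for S w
    using someI_ex[OF h_ex[of S w]] unfolding h_def[symmetric] by (rule conjunct1, rule conjunct2)
  have h_eq: "h S w = h S w'" if "conn S w w'" for S w w'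
  proof -
    have "conn S w = conn S w'"
      by (intro ext iffI) (erule conn_trans[OF conn_sym[OF that]], erule conn_trans[OF that])
    then show ?thesis by (simp add: h_def)
  qed
  have hW: "h S w \<in> W" if "S \<in> Pow I" "w \<in> W" for S w
    using h(1)[of S w]
  proof (induction rule: conn_induct)
    case (step y z)
    then show ?case using I that(1) by blast
  qed (rule that(2))
  have hh: "h S (h S w) = h S w" for S w using h_eq[OF h(1)] by simp
  have hN: "h S w \<in> ?N" if "w \<in> ?N" for S w using h(2)[of S w] that conn_refl[of S w] by blast
  define V where "V = W \<union> L"
  define t where "t S B = partition_of (star_type V (B \<union> L) (\<lambda>v. if v \<in> W then h S v else h S (p v)))" for S B
  define \<mu> where "\<mu> = partition_of (star_type V L p)"
  let ?R = "\<lambda>S. {w \<in> W. h S w \<noteq> w}"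
  have sep: "separated ?N S \<longleftrightarrow> (\<forall>w\<in>?N. h S w = w)" for S
  proof
    assume s: "separated ?N S"
    show "\<forall>w\<in>?N. h S w = w"
    proof
      fix w assume w: "w \<in> ?N"
      show "h S w = w" using separatedD[OF s w hN[OF w] h(1)] by simp
    qed
  next
    assume id: "\<forall>w\<in>?N. h S w = w"
    show "separated ?N S"
      unfolding separated_def
    proof (intro ballI impI)
      fix v w assume vw: "v \<in> ?N" "w \<in> ?N" "conn S v w"
      have "v = h S v" by (rule bspec[OF id vw(1), symmetric])
      also have "\<dots> = h S w" by (rule h_eq[OF vw(3)])
      also have "\<dots> = w" by (rule bspec[OF id vw(2)])
      finally show "v = w" .
    qed
  qed
  have t_eq: "t S B = \<mu>" if "S \<in> Pow I" "B \<in> Pow (?R S)" "B = {}" "separated ?N S" for S B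
  proof -
    have "\<forall>w\<in>?N. h S w = w" using that(4) by (simp only: sep)
    then have "star_type V (B \<union> L) (\<lambda>v. if v \<in> W then h S v else h S (p v)) = star_type V L p"
      unfolding V_def using fin(1,2) disj p hW[OF that(1)] hh hN that(2,3)
      by (intro star_type_clusters(1)) auto
    then show ?thesis by (simp add: t_def \<mu>_def)
  qed
  have t_gr: "\<mu> < t S B" if "S \<in> Pow I" "B \<in> Pow (?R S)" "\<not> (B = {} \<and> separated ?N S)" for S B
    unfolding t_def \<mu>_def V_def using fin(1,2) disj p hW[OF that(1)] hh hN that(2,3)[unfolded sep]
    by (intro star_type_clusters(2)) auto
  define J where "J = (SIGMA S:Pow I. Pow (?R S))"
  have finR: "finite (Pow (?R S))" for S using fin(1) by simp
  have finJ: "finite J" unfolding J_def using fin(3) finR by (intro finite_SigmaI) auto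
  have forest: "B \<union> L \<subseteq> V" "(\<lambda>v. if v \<in> W then h S v else h S (p v)) ` (B \<union> L) \<subseteq> V - (B \<union> L)"
    if "(S, B) \<in> J" for S B
  proof -
    have S: "S \<in> Pow I" and B: "B \<subseteq> ?R S" using that by (auto simp: J_def)
    show "B \<union> L \<subseteq> V" using B by (auto simp: V_def)
    have "h S w \<in> W \<and> h S w \<notin> B \<union> L" if "w \<in> W" for w
      using hW[OF S that] hh[of S w] B disj by auto
    then show "(\<lambda>v. if v \<in> W then h S v else h S (p v)) ` (B \<union> L) \<subseteq> V - (B \<union> L)"
      using B p disj by (auto simp: V_def)
  qed
  have finV: "finite V" using fin by (simp add: V_def)
  show ?thesis
    unfolding V_def[symmetric]
  proof (rule leading_coeff_eqI[where J = J and t = "\<lambda>(S, B). t S B" and \<mu> = \<mu>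
        and a = "\<lambda>(S, B). (- 1) ^ card S * (- 1) ^ card B"])
    show "finite J" by (rule finJ)
    show "(case j of (S, B) \<Rightarrow> t S B) \<in> partitions (card V)" if "j \<in> J" for j
    proof (cases j)
      case (Pair S B)
      have "(S, B) \<in> J" using that Pair by simp
      from partition_of_star_type[OF finV forest[OF this]] show ?thesis by (simp add: Pair t_def)
    qed
    show "\<mu> \<le> (case j of (S, B) \<Rightarrow> t S B)" if "j \<in> J" for j
    proof (cases j)
      case (Pair S B)
      then have SB: "S \<in> Pow I" "B \<in> Pow (?R S)" using that by (auto simp: J_def)
      have "\<mu> \<le> t S B"
      proof (cases "B = {} \<and> separated ?N S")
        case True
        then show ?thesis using t_eq[OF SB] by simp
      next
        case False
        then show ?thesis using t_gr[OF SB False] by simp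
      qed
      then show ?thesis by (simp add: Pair)
    qed
    show "chromatic_symfun V (I \<union> {{l, p l} | l. l \<in> L}) M =
      (\<Sum>j\<in>J. (case j of (S, B) \<Rightarrow> (- 1) ^ card S * (- 1) ^ card B) *
        star_product (case j of (S, B) \<Rightarrow> t S B) M)" for M
    proof -
      have "chromatic_symfun V (I \<union> {{l, p l} | l. l \<in> L}) M =
        (\<Sum>S\<in>Pow I. \<Sum>B\<in>Pow (?R S). (- 1) ^ card S * (- 1) ^ card B *
          chromatic_symfun V {{v, if v \<in> W then h S v else h S (p v)} | v. v \<in> B \<union> L} M)"
        unfolding V_def by (rule chromatic_symfun_leaves[OF fin disj p I h(1) h_eq])
      also have "\<dots> = (\<Sum>S\<in>Pow I. \<Sum>B\<in>Pow (?R S). (- 1) ^ card S * (- 1) ^ card B * star_product (t S B) M)"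
      proof (intro sum.cong refl arg_cong2[where f = "(*)"])
        fix S B assume "S \<in> Pow I" "B \<in> Pow (?R S)"
        then have "(S, B) \<in> J" by (auto simp: J_def)
        from chromatic_symfun_star_type[OF finV forest[OF this]]
        show "chromatic_symfun V {{v, if v \<in> W then h S v else h S (p v)} | v. v \<in> B \<union> L} M =
          star_product (t S B) M" by (simp only: t_def)
      qed
      also have "\<dots> = (\<Sum>(S, B)\<in>J. (- 1) ^ card S * (- 1) ^ card B * star_product (t S B) M)"
        unfolding J_def using fin(3) finR by (intro sum.Sigma) auto
      finally show ?thesis by (simp only: case_prod_unfold)
    qed
    have "(\<Sum>j\<in>J. (case j of (S, B) \<Rightarrow> (- 1) ^ card S * (- 1) ^ card B) *
        of_bool ((case j of (S, B) \<Rightarrow> t S B) = \<mu>) :: rat) =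
      (\<Sum>(S, B)\<in>J. (- 1) ^ card S * (- 1) ^ card B * of_bool (t S B = \<mu>))"
      by (simp only: case_prod_unfold)
    also have "\<dots> = (\<Sum>S\<in>Pow I. \<Sum>B\<in>Pow (?R S). (- 1) ^ card S * (- 1) ^ card B * of_bool (t S B = \<mu>))"
      unfolding J_def using fin(3) finR by (intro sum.Sigma[symmetric]) auto
    also have "\<dots> = (\<Sum>S\<in>Pow I. (- 1) ^ card S * of_bool (separated ?N S))"
    proof (rule sum.cong[OF refl])
      fix S assume S: "S \<in> Pow I"
      \<comment> \<open>For nonempty \<open>B\<close> the type is strictly larger than
        \<open>\<mu>\<close>, so only the term of the empty set survives.\<close>
      have "(\<Sum>B\<in>Pow (?R S). (- 1) ^ card S * (- 1) ^ card B * of_bool (t S B = \<mu>) :: rat) =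
        (\<Sum>B\<in>{{}}. (- 1) ^ card S * (- 1) ^ card B * of_bool (t S B = \<mu>))"
      proof (rule sum.mono_neutral_right[OF finR])
        show "\<forall>B\<in>Pow (?R S) - {{}}. (- 1) ^ card S * (- 1) ^ card B * of_bool (t S B = \<mu>) = (0 :: rat)"
        proof
          fix B assume B: "B \<in> Pow (?R S) - {{}}"
          have "\<mu> < t S B" by (rule t_gr[OF S]) (use B in auto)
          then show "(- 1) ^ card S * (- 1) ^ card B * of_bool (t S B = \<mu>) = (0 :: rat)" by simp
        qed
      qed simp
      moreover have "t S {} = \<mu> \<longleftrightarrow> separated ?N S"
      proof (cases "separated ?N S")
        case True
        then show ?thesis using t_eq[OF S, of "{}"] by simp
      next
        case False
        then have "\<mu> < t S {}" by (intro t_gr[OF S]) simp_all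
        then show ?thesis using False by simp
      qed
      ultimately show "(\<Sum>B\<in>Pow (?R S). (- 1) ^ card S * (- 1) ^ card B * of_bool (t S B = \<mu>) :: rat) =
        (- 1) ^ card S * of_bool (separated ?N S)" by (simp only: sum.insert sum.empty finite.emptyI) simp
    qed
    finally show "(\<Sum>j\<in>J. (case j of (S, B) \<Rightarrow> (- 1) ^ card S * (- 1) ^ card B) *
        of_bool ((case j of (S, B) \<Rightarrow> t S B) = \<mu>)) = x" by (simp only: nz(1))
    show "x \<noteq> 0" by (rule nz(2))
  qed
qed

section \<open>Unicyclic graphs\<close>

text \<open>Loop erasure: when the next vertex already lies on the path, the path is cut back to
  it.\<close>

lemma conn_distinct_path:
  assumes "conn D x y"
  shows "\<exists>vs. vs \<noteq> [] \<and> hd vs = x \<and> last vs = y \<and> distinct vs \<and> successively (\<lambda>a b. {a, b} \<in> D) vs"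
  using assms
proof (induction rule: conn_induct)
  case refl
  show ?case by (rule exI[of _ "[x]"]) simp
next
  case (step y z)
  then obtain vs where vs: "vs \<noteq> []" "hd vs = x" "last vs = y" "distinct vs"
    "successively (\<lambda>a b. {a, b} \<in> D) vs" by blast
  show ?case
  proof (cases "z \<in> set vs")
    case True
    then obtain ys zs where split: "vs = ys @ z # zs" by (meson split_list)
    have "hd (ys @ [z]) = x" using vs(2) split by (cases ys) auto
    moreover have "distinct (ys @ [z])" using vs(4) split by auto
    moreover have "successively (\<lambda>a b. {a, b} \<in> D) (ys @ [z])"
      using vs(5) split by (auto simp: successively_append_iff)
    ultimately show ?thesis by (intro exI[of _ "ys @ [z]"]) simp
  next
    case False
    have "successively (\<lambda>a b. {a, b} \<in> D) (vs @ [z])"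
      using vs(3,5) step.hyps(2) by (auto simp: successively_append_iff)
    then show ?thesis using vs False by (intro exI[of _ "vs @ [z]"]) simp
  qed
qed

text \<open>The edge closes a path that avoids it. The path has at least three vertices, since with
  two it would be the deleted edge.\<close>

lemma closed_edge_conn_cycle:
  assumes "{u, v} \<in> C" "u \<noteq> v" "conn (C - {{u, v}}) u v"
  shows "\<exists>vs. length vs \<ge> 3 \<and> distinct vs \<and> closed_walk_edges vs \<subseteq> C"
proof -
  let ?D = "C - {{u, v}}"
  obtain vs where vs: "vs \<noteq> []" "hd vs = u" "last vs = v" "distinct vs"
    "successively (\<lambda>a b. {a, b} \<in> ?D) vs"
    using conn_distinct_path[OF assms(3)] by blast
  have step: "{vs ! i, vs ! Suc i} \<in> ?D" if "Suc i < length vs" for i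
    using vs(5) that by (simp add: successively_conv_nth)
  have hd: "vs ! 0 = u" using vs(1,2) by (simp add: hd_conv_nth)
  have last: "vs ! (length vs - 1) = v" using vs(1,3) by (simp add: last_conv_nth)
  have "length vs \<noteq> 0" "length vs \<noteq> 1" "length vs \<noteq> 2"
  proof -
    show "length vs \<noteq> 0" using vs(1) by simp
    show "length vs \<noteq> 1" using hd last assms(2) by auto
    show "length vs \<noteq> 2" using step[of 0] hd last by auto
  qed
  then have len: "length vs \<ge> 3" by linarith
  \<comment> \<open>At the last index the successor wraps around to 0, which gives the closing
    edge.\<close>
  have "{vs ! i, vs ! (Suc i mod length vs)} \<in> C" if i: "i < length vs" for i
  proof (cases "Suc i = length vs")
    case True
    then have "i = length vs - 1" by simp
    then have "vs ! i = v" "vs ! (Suc i mod length vs) = u" using hd last True by simp_all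
    then show ?thesis using assms(1) by (simp add: insert_commute)
  next
    case False
    then have "Suc i < length vs" using i by simp
    then show ?thesis using step[of i] by simp
  qed
  then have "closed_walk_edges vs \<subseteq> C" by (auto simp: closed_walk_edges_def)
  then show ?thesis using len vs(4) by blast
qed

lemma closed_walk_edges_conn:
  assumes "closed_walk_edges vs \<subseteq> C" "x \<in> \<Union>(closed_walk_edges vs)" "y \<in> \<Union>(closed_walk_edges vs)"
  shows "conn C x y"
proof -
  have edge: "{vs ! i, vs ! (Suc i mod length vs)} \<in> C" if "i < length vs" for i
    using that assms(1) by (auto simp: closed_walk_edges_def)
  have start: "conn C (vs ! 0) (vs ! i)" if "i < length vs" for i
    using that
  proof (induction i)
    case (Suc i)
    then have "{vs ! i, vs ! Suc i} \<in> C" using edge[of i] by simp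
    from conn_trans[OF Suc.IH conn_edge[OF this]] Suc.prems show ?case by simp
  qed simp
  have pos: "\<exists>i<length vs. z = vs ! i" if z: "z \<in> \<Union>(closed_walk_edges vs)" for z
  proof -
    obtain i where i: "i < length vs" "z \<in> {vs ! i, vs ! (Suc i mod length vs)}"
      using z by (auto simp: closed_walk_edges_def)
    moreover have "Suc i mod length vs < length vs" using i(1) by (intro mod_less_divisor) linarith
    ultimately show ?thesis by blast
  qed
  obtain i j where "i < length vs" "x = vs ! i" "j < length vs" "y = vs ! j"
    using pos[OF assms(2)] pos[OF assms(3)] by blast
  then show ?thesis using conn_trans[OF conn_sym[OF start] start] by simp
qed

text \<open>These are the edges to the successor and from the predecessor; they differ because the
  cycle has at least three vertices.\<close>

lemma two_cycle_edges_at_vertex: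
  assumes len: "length vs \<ge> 3" and dist: "distinct vs" and v: "v \<in> \<Union>(closed_walk_edges vs)"
  shows "\<exists>e e'. e \<noteq> e' \<and> e \<in> closed_walk_edges vs \<and> e' \<in> closed_walk_edges vs \<and> v \<in> e \<and> v \<in> e'"
proof -
  let ?n = "length vs"
  have pos: "Suc k mod ?n < ?n" for k using len by (intro mod_less_divisor) linarith
  obtain i where i: "i < ?n" "v = vs ! i"
    using v pos by (auto simp: closed_walk_edges_def)
  define j where "j = (if i = 0 then ?n - 1 else i - 1)"
  have j: "j < ?n" "Suc j mod ?n = i" using i len by (auto simp: j_def)
  have "Suc i mod ?n = (if Suc i = ?n then 0 else Suc i)" using i by simp
  then have ne: "Suc i mod ?n \<noteq> j" "Suc i mod ?n \<noteq> i" using len i(1) by (auto simp: j_def split: if_splits)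
  have diff: "{vs ! i, vs ! (Suc i mod ?n)} \<noteq> {vs ! j, vs ! (Suc j mod ?n)}"
  proof
    assume "{vs ! i, vs ! (Suc i mod ?n)} = {vs ! j, vs ! (Suc j mod ?n)}"
    then have "vs ! (Suc i mod ?n) = vs ! j \<or> vs ! (Suc i mod ?n) = vs ! i"
      unfolding j(2) by (auto simp: doubleton_eq_iff)
    then show False using ne nth_eq_iff_index_eq[OF dist] pos j(1) i(1) by auto
  qed
  have edge: "{vs ! k, vs ! (Suc k mod ?n)} \<in> closed_walk_edges vs" if "k < ?n" for k
    using that by (auto simp: closed_walk_edges_def)
  show ?thesis
  proof (intro exI conjI)
    show "v \<in> {vs ! i, vs ! (Suc i mod ?n)}" by (simp add: i(2))
    show "v \<in> {vs ! j, vs ! (Suc j mod ?n)}" by (simp add: i(2) j(2))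
  qed (rule diff edge[OF i(1)] edge[OF j(1)])+
qed

theorem proposition6p6:
  fixes V :: "'a set" and E :: "'a set set"
  assumes "simple_graph V E"
    and "connected_graph V E"
    and "unicyclic E"
    and "\<not> (\<exists>v. sprout V E v)"
    and "card (nontrivial_roots V E) \<ge> 2"
  shows "leading_coeff (card V) (chromatic_symfun V E) =
    (- 1) ^ card {u. deep V E u} * (\<Prod>u | deep V E u. rat_of_nat (degree E u) - 1)"
proof -
  have edge: "e \<subseteq> V \<and> card e = 2" if "e \<in> E" for e
    using assms(1) that by (auto simp: simple_graph_def)
  have finV: "finite V" using assms(1) by (simp add: simple_graph_def)
  have finE: "finite E" by (rule finite_subset[of _ "Pow V"]) (use edge finV in auto)
  have other: "\<exists>w. e = {v, w} \<and> w \<noteq> v" if "e \<in> E" "v \<in> e" for e v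
    using edge[OF that(1)] that(2) by (auto simp: card_2_iff)
  have conn_E: "conn E u v" if "u \<in> V" "v \<in> V" for u v
    using assms(2) that by (simp add: connected_graph_def conn_def)
  define Z where "Z = the_cycle E"
  have Z_eq: "C = Z" if "C \<in> cycles E" for C
    using assms(3) that unfolding unicyclic_def Z_def the_cycle_def by (metis the1_equality)
  have "Z \<in> cycles E"
    using assms(3) unfolding unicyclic_def Z_def the_cycle_def by (rule theI')
  then obtain cs where cs: "Z = closed_walk_edges cs" "length cs \<ge> 3" "distinct cs" "Z \<subseteq> E"
    by (auto simp: cycles_def)
  define W where "W = {v \<in> V. degree E v \<ge> 2}"
  define L where "L = {v \<in> V. degree E v = 1}"
  define I where "I = {e \<in> E. e \<subseteq> W}"
  define p where "p l = (SOME q. {l, q} \<in> E)" for l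
  \<comment> \<open>A root has two cycle edges and at least one edge into its tree.\<close>
  have root_degree: "v \<in> V \<and> degree E v \<ge> 3" if v: "v \<in> nontrivial_roots V E" for v
  proof -
    have vZ: "v \<in> \<Union>Z" and "card (component V (E - Z) v) > 1"
      using v by (auto simp: nontrivial_roots_def cycle_vertices_def rooted_tree_def Z_def)
    then have "\<not> component V (E - Z) v \<subseteq> {v}"
      using card_mono[of "{v}" "component V (E - Z) v"] by auto
    then obtain w where w: "conn (E - Z) v w" "v \<noteq> w" by (auto simp: component_def conn_def)
    obtain u where u: "{v, u} \<in> E - Z" using conn_first_edge[OF w] by blast
    obtain e e' where e: "e \<noteq> e'" "e \<in> Z" "e' \<in> Z" "v \<in> e" "v \<in> e'"
      using two_cycle_edges_at_vertex[OF cs(2,3)] vZ cs(1) by blast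
    have "card {{v, u}, e, e'} = 3" using u e by (auto simp: card_insert_if)
    moreover have "{{v, u}, e, e'} \<subseteq> {e \<in> E. v \<in> e}" using u e cs(4) by auto
    ultimately have "3 \<le> degree E v"
      unfolding degree_def using finE card_mono[of "{e \<in> E. v \<in> e}" "{{v, u}, e, e'}"] by simp
    then show ?thesis using vZ cs(4) edge by blast
  qed
  \<comment> \<open>A cycle vertex of degree at least three that is not a sprout cannot be deep, so
    it has an adjacent leaf.\<close>
  have root_leaf: "\<exists>l. leaf V E l \<and> {v, l} \<in> E" if v: "v \<in> nontrivial_roots V E" for v
  proof -
    have "v \<in> cycle_vertices E" using v by (simp add: nontrivial_roots_def)
    then have "\<not> deep V E v" using assms(4) root_degree[OF v] by (auto simp: sprout_def)
    then show ?thesis using root_degree[OF v] by (auto simp: deep_def internal_def)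
  qed
  obtain x0 y0 where roots: "x0 \<in> nontrivial_roots V E" "y0 \<in> nontrivial_roots V E" "x0 \<noteq> y0"
    using assms(5) by (auto simp: numeral_2_eq_2 card_le_Suc_iff)
  \<comment> \<open>Without isolated vertices, every vertex is internal or a leaf.\<close>
  have nonzero_degree: "degree E v \<ge> 1" if v: "v \<in> V" for v
  proof (cases "v = x0")
    case False
    have "conn E v x0" using v root_degree[OF roots(1)] by (intro conn_E) auto
    from conn_first_edge[OF this False] obtain u where "{v, u} \<in> E" by blast
    then have "{e \<in> E. v \<in> e} \<noteq> {}" by auto
    then show ?thesis using finE by (simp add: degree_def card_gt_0_iff Suc_le_eq)
  qed (use root_degree[OF roots(1)] in auto)
  have V: "V = W \<union> L" and disj: "W \<inter> L = {}"
    using nonzero_degree by (force simp: W_def L_def)+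
  have leaf_edges: "{e \<in> E. l \<in> e} = {{l, p l}} \<and> p l \<noteq> l" if l: "l \<in> L" for l
  proof -
    obtain e where e: "{e \<in> E. l \<in> e} = {e}" using l by (auto simp: L_def degree_def card_1_singleton_iff)
    then obtain q where q: "e = {l, q}" "q \<noteq> l" using other[of e l] by blast
    have "{l, p l} \<in> E" unfolding p_def by (rule someI[of _ q]) (use e q in auto)
    then have "{l, p l} \<in> {e \<in> E. l \<in> e}" by simp
    then have "{l, p l} = {l, q}" unfolding e using q by simp
    then have "p l = q" using q(2) by (auto simp: doubleton_eq_iff)
    then show ?thesis using e q by simp
  qed
  have pE: "{l, p l} \<in> E" if "l \<in> L" for l using leaf_edges[OF that] by blast
  \<comment> \<open>Two adjacent leaves would form a whole component, which by connectedness would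
    contain \<open>x0\<close>; but \<open>x0\<close> has degree at least three.\<close>
  have p: "p ` L \<subseteq> W"
  proof (rule image_subsetI, rule ccontr)
    fix l assume l: "l \<in> L" "p l \<notin> W"
    then have pl: "p l \<in> L" using pE[OF l(1)] edge V by blast
    have "{p l, l} \<in> {e \<in> E. p l \<in> e}" using pE[OF l(1)] by (simp add: insert_commute)
    then have "{p l, l} = {p l, p (p l)}" using leaf_edges[OF pl] by simp
    then have ppl: "p (p l) = l" by (auto simp: doubleton_eq_iff)
    have next_edge: "{z, z'} = {z, p z}" if "z \<in> L" "{z, z'} \<in> E" for z z'
    proof -
      have "{z, z'} \<in> {e \<in> E. z \<in> e}" using that(2) by simp
      also have "\<dots> = {{z, p z}}" using leaf_edges[OF that(1)] by simp
      finally show ?thesis by simp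
    qed
    have "x0 \<in> {l, p l}"
    proof -
      have "l \<in> V" "x0 \<in> V" using l(1) root_degree[OF roots(1)] by (auto simp: L_def)
      then have "conn E l x0" by (rule conn_E)
      then show ?thesis
      proof (induction rule: conn_induct)
        case (step y z)
        then have "y \<in> L" using l pl by auto
        from next_edge[OF this step.hyps(2)] show ?case
          using step.IH ppl by (auto simp: doubleton_eq_iff)
      qed simp
    qed
    then have "degree E x0 = 1" using l pl by (auto simp: L_def)
    then show False using root_degree[OF roots(1)] by simp
  qed
  have E: "E = I \<union> {{l, p l} | l. l \<in> L}"
  proof (intro subset_antisym subsetI)
    fix e assume e: "e \<in> E"
    show "e \<in> I \<union> {{l, p l} | l. l \<in> L}"
    proof (cases "e \<subseteq> W")
      case False
      then obtain l where l: "l \<in> e" "l \<in> L" using edge[OF e] V by blast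
      then have "e \<in> {e \<in> E. l \<in> e}" using e by simp
      then have "e = {l, p l}" using leaf_edges[OF l(2)] by simp
      then show ?thesis using l(2) by blast
    qed (use e I_def in simp)
  qed (use pE I_def in auto)
  have I: "e \<subseteq> W \<and> card e = 2" if "e \<in> I" for e using that edge by (auto simp: I_def)
  have finW: "finite W" "finite L" "finite I" using finV finE by (auto simp: W_def L_def I_def)
  let ?N = "p ` L"
  have leaf_at: "(\<exists>l. leaf V E l \<and> {v, l} \<in> E) \<longleftrightarrow> v \<in> ?N" for v
  proof
    assume "\<exists>l. leaf V E l \<and> {v, l} \<in> E"
    then obtain l where l: "l \<in> L" "{v, l} \<in> E" by (auto simp: leaf_def L_def)
    then have "{v, l} \<in> {e \<in> E. l \<in> e}" by simp
    then have "{v, l} = {l, p l}" using leaf_edges[OF l(1)] by simp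
    then have "v = p l" by (auto simp: doubleton_eq_iff)
    then show "v \<in> ?N" using l(1) by blast
  next
    assume "v \<in> ?N"
    then obtain l where l: "l \<in> L" "v = p l" by auto
    then have "leaf V E l \<and> {v, l} \<in> E" using pE[OF l(1)] by (simp add: leaf_def L_def insert_commute)
    then show "\<exists>l. leaf V E l \<and> {v, l} \<in> E" by blast
  qed
  have deep: "deep V E v \<longleftrightarrow> v \<in> W - ?N" for v
    unfolding deep_def leaf_at by (auto simp: internal_def W_def)
  \<comment> \<open>A deep vertex has no edge to a leaf, so all its edges are counted in
    \<open>I\<close>.\<close>
  have deep_degree: "degree I v = degree E v" if v: "v \<in> W - ?N" for v
  proof -
    have "e \<in> I" if "e \<in> E" "v \<in> e" for e
    proof (rule ccontr)
      assume "e \<notin> I"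
      then obtain l where "l \<in> L" "e = {l, p l}" using E \<open>e \<in> E\<close> by blast
      then show False using \<open>v \<in> e\<close> v disj by auto
    qed
    then have "{e \<in> I. v \<in> e} = {e \<in> E. v \<in> e}" by (auto simp: I_def)
    then show ?thesis by (simp add: degree_def)
  qed
  \<comment> \<open>A cycle in \<open>C\<close> would be the unique cycle \<open>Z\<close>. It would
    join the roots \<open>x0\<close> and \<open>y0\<close>, which are distinct vertices of
    \<open>?N\<close>.\<close>
  have forest: "\<not> conn (C - {{u, v}}) u v"
    if C: "C \<subseteq> I" "separated ?N C" "{u, v} \<in> C" for C u v
  proof
    assume conn: "conn (C - {{u, v}}) u v"
    have "{u, v} \<in> I" using C by blast
    then have "u \<noteq> v" using I[of "{u, v}"] by auto
    then obtain vs where vs: "length vs \<ge> 3" "distinct vs" "closed_walk_edges vs \<subseteq> C"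
      using closed_edge_conn_cycle[OF C(3) _ conn] by blast
    have "closed_walk_edges vs \<subseteq> E" using vs(3) C(1) by (auto simp: I_def)
    then have "closed_walk_edges vs \<in> cycles E" using vs(1,2) by (auto simp: cycles_def)
    then have Z: "closed_walk_edges vs = Z" by (rule Z_eq)
    have "x0 \<in> \<Union>Z" "y0 \<in> \<Union>Z" using roots by (auto simp: nontrivial_roots_def cycle_vertices_def Z_def)
    then have "conn C x0 y0" using vs(3) unfolding Z[symmetric] by (intro closed_walk_edges_conn) auto
    moreover have "x0 \<in> ?N" "y0 \<in> ?N" using root_leaf roots leaf_at by auto
    ultimately show False using separatedD[OF C(2)] roots(3) by blast
  qed
  have W: "?N \<union> (W - ?N) = W" using p by auto
  have "(\<Sum>S\<in>Pow I. (- 1) ^ card S * of_bool (separated ?N S)) =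
    (\<Prod>v\<in>W - ?N. 1 - rat_of_nat (degree I v))"
    by (rule sum_separated) (use finW I forest W in auto)
  also have "\<dots> = (\<Prod>v\<in>W - ?N. (- 1) * (rat_of_nat (degree E v) - 1))"
    by (intro prod.cong refl) (simp add: deep_degree)
  also have "\<dots> = (- 1) ^ card (W - ?N) * (\<Prod>v\<in>W - ?N. rat_of_nat (degree E v) - 1)"
    by (simp only: prod.distrib prod_constant)
  finally have sum: "(\<Sum>S\<in>Pow I. (- 1) ^ card S * of_bool (separated ?N S)) =
    (- 1) ^ card (W - ?N) * (\<Prod>v\<in>W - ?N. rat_of_nat (degree E v) - 1)" .
  \<comment> \<open>Internal vertices have degree at least two, so the coefficient at the smallest
    type does not vanish and is indeed the leading one.\<close>
  have "rat_of_nat (degree E v) - 1 \<noteq> 0" if "v \<in> W - ?N" for v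
    using that by (auto simp: W_def)
  then have "(- 1) ^ card (W - ?N) * (\<Prod>v\<in>W - ?N. rat_of_nat (degree E v) - 1) \<noteq> 0"
    using finW by simp
  from leading_coeff_leaves[OF finW disj p I sum this]
  have "leading_coeff (card V) (chromatic_symfun V E) =
    (- 1) ^ card (W - ?N) * (\<Prod>v\<in>W - ?N. rat_of_nat (degree E v) - 1)"
    by (simp only: V[symmetric] E[symmetric])
  moreover have "{u. deep V E u} = W - ?N" using deep by blast
  ultimately show ?thesis by simp
qed

end
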